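(* Let $[u]=2\sqrt{-1}\sin(\pi u/\omega_1)$, $\rho=2$ (trigonometric case), respectively $[u]=u$, $\rho=1$ (rational case). Let $\delta,\kappa\in\mathbb{C}\setminus\Omega$, $\mu=(\mu_1,\dots,\mu_{2\rho})\in\mathbb{C}^{2\rho}$, let $m,n\ge0$ be integers, and let $x=(x_1,\dots,x_m)$, $y=(y_1,\dots,y_n)$. (1) Let $G(u|\delta)$ be a nonzero meromorphic function with $G(u+\delta|\delta)=c_0\,[u]\,G(u|\delta)$ for some nonzero constant $c_0$, and let $\Phi_{BC}(x;y|\delta,\kappa)$ be either of the two functions $$\prod_{j=1}^{m}\prod_{l=1}^{n}\frac{G(x_j\pm y_l+\frac12(\delta-\kappa)|\delta)}{G(x_j\pm y_l+\frac12(\delta+\kappa)|\delta)}\qquad\text{or}\qquad \prod_{j=1}^{m}\prod_{l=1}^{n}\prod_{\epsilon_1,\epsilon_2=\pm}G(\epsilon_1x_j+\epsilon_2y_l+\tfrac12(\delta-\kappa)|\delta).$$ Then, with $\nu_r=\frac12(\delta+\kappa)-\mu_r$ $(r=1,\dots,2\rho)$, $$[\kappa]D_x^{(\mu|\delta,\kappa)}\Phi_{BC}(x;y|\delta,\kappa)-[\kappa]D_y^{(\nu|\delta,\kappa)}\Phi_{BC}(x;y|\delta,\kappa)$$ is equal to $[m\kappa]\,[-n\kappa]\,\big[(m-n)\kappa+c^{(\mu|\delta,\kappa)}\big]\,\Phi_{BC}(x;y|\delta,\kappa)$ in the trigonometric case, and to $0$ in the rational case. (2) For $\Psi_{BC}(x;y)=\prod_{j=1}^{m}\prod_{l=1}^{n}[x_j\pm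 y_l]$, $$[\kappa]D_x^{(\mu|\delta,\kappa)}\Psi_{BC}(x;y)+[\delta]D_y^{(\mu|\kappa,\delta)}\Psi_{BC}(x;y)$$ is equal to $[m\kappa]\,[n\delta]\,\big[m\kappa+n\delta+c^{(\mu|\delta,\kappa)}\big]\,\Psi_{BC}(x;y)$ in the trigonometric case, and to $0$ in the rational case.
   Context: Notation: $\Omega$ is the zero set of $[u]$: $\Omega=\mathbb{Z}\omega_1$ with $\omega_1\neq0$ in the trigonometric case, where one also puts $\omega_2=0$; $\Omega=0$ in the rational case, where one puts $\omega_1=0$. The symbol $\pm$ inside a function denotes a product over both signs, e.g. $[x\pm y]=[x+y][x-y]$, $G(x\pm y+c)=G(x+y+c)G(x-y+c)$, $[x\pm y+c]=[x+y+c][x-y+c]$. $T_{x_i}^{\pm\delta}$ shifts $x_i\mapsto x_i\pm\delta$. Put $$c^{(\mu|\delta,\kappa)}=\sum_{s=1}^{2\rho}\mu_s-\tfrac{\rho}{2}(\delta+\kappa)+\sum_{s=1}^{\rho}\omega_s .$$ For $N$ variables $x=(x_1,\dots,x_N)$ define $$D_x^{(\mu|\delta,\kappa)}=\sum_{i=1}^{N}A_i^{+}(x)\big(T_{x_i}^{\delta}-1\big)+\sum_{i=1}^{N}A_i^{-}(x)\big(T_{x_i}^{-\delta}-1\big),$$ $$A_i^{+}(x)=\frac{\prod_{s=1}^{2\rho}[x_i+\mu_s]}{\prod_{s=1}^{\rho}[x_i-\frac12\omega_s][x_i+\frac12(\delta-\omega_s)]}\prod_{1\le j\le N,\,j\ne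 i}\frac{[x_i\pm x_j+\kappa]}{[x_i\pm x_j]},\qquad A_i^{-}(x)=A_i^{+}(-x).$$ Operators with subscript $x$ use $N=m$, those with subscript $y$ use $N=n$. $D_y^{(\mu|\kappa,\delta)}$ is obtained by exchanging $\delta$ and $\kappa$ in the definition (so the shifts are by $\pm\kappa$). *)

theory Defs
  imports "HOL-Complex_Analysis.Complex_Analysis"
begin

text \<open>
  Vectors \<open>(v\<^sub>1, \<dots>, v\<^sub>N)\<close> are functions of type \<^typ>\<open>nat \<Rightarrow> complex\<close> of which only the
  entries with index in \<open>{1..N}\<close> are used.

  The argument of \<open>Trigonometric\<close> is the period \<open>\<omega>\<^sub>1\<close>; that it is nonzero is an assumption
  of the theorem.
\<close>

datatype bc_case = Trigonometric complex | Rational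

fun br :: "bc_case \<Rightarrow> complex \<Rightarrow> complex" where
  "br (Trigonometric \<omega>\<^sub>1) u = 2 * \<i> * sin (of_real pi * u / \<omega>\<^sub>1)"
| "br Rational u = u"

fun rho :: "bc_case \<Rightarrow> nat" where
  "rho (Trigonometric _) = 2"
| "rho Rational = 1"

fun omega :: "bc_case \<Rightarrow> nat \<Rightarrow> complex" where
  "omega (Trigonometric \<omega>\<^sub>1) s = (if s = 1 then \<omega>\<^sub>1 else 0)"
| "omega Rational s = 0"

definition Omega :: "bc_case \<Rightarrow> complex set" where
  "Omega C = {u. br C u = 0}"

definition c_const :: "bc_case \<Rightarrow> (nat \<Rightarrow> complex) \<Rightarrow> complex \<Rightarrow> complex \<Rightarrow> complex" where
  "c_const C \<mu> \<delta> \<kappa> =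
     (\<Sum>s = 1..2 * rho C. \<mu> s) - of_nat (rho C) / 2 * (\<delta> + \<kappa>) + (\<Sum>s = 1..rho C. omega C s)"

text \<open>\<open>pm f u v c\<close> is the double-sign product \<open>f(u \<plusminus> v + c)\<close>.\<close>

definition pm :: "(complex \<Rightarrow> complex) \<Rightarrow> complex \<Rightarrow> complex \<Rightarrow> complex \<Rightarrow> complex" where
  "pm f u v c = f (u + v + c) * f (u - v + c)"

definition A_plus ::
  "bc_case \<Rightarrow> (nat \<Rightarrow> complex) \<Rightarrow> complex \<Rightarrow> complex \<Rightarrow> nat \<Rightarrow> nat \<Rightarrow> (nat \<Rightarrow> complex) \<Rightarrow> complex" where
  "A_plus C \<mu> \<delta> \<kappa> N i x =
     (\<Prod>s = 1..2 * rho C. br C (x i + \<mu> s)) /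
     (\<Prod>s = 1..rho C. br C (x i - omega C s / 2) * br C (x i + (\<delta> - omega C s) / 2)) *
     (\<Prod>j\<in>{1..N} - {i}. pm (br C) (x i) (x j) \<kappa> / pm (br C) (x i) (x j) 0)"

definition A_minus ::
  "bc_case \<Rightarrow> (nat \<Rightarrow> complex) \<Rightarrow> complex \<Rightarrow> complex \<Rightarrow> nat \<Rightarrow> nat \<Rightarrow> (nat \<Rightarrow> complex) \<Rightarrow> complex" where
  "A_minus C \<mu> \<delta> \<kappa> N i x = A_plus C \<mu> \<delta> \<kappa> N i (\<lambda>j. - x j)"

definition shift :: "nat \<Rightarrow> complex \<Rightarrow> (nat \<Rightarrow> complex) \<Rightarrow> nat \<Rightarrow> complex" where
  "shift i d x = x(i := x i + d)"

definition D_op ::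
  "bc_case \<Rightarrow> (nat \<Rightarrow> complex) \<Rightarrow> complex \<Rightarrow> complex \<Rightarrow> nat \<Rightarrow>
   ((nat \<Rightarrow> complex) \<Rightarrow> complex) \<Rightarrow> (nat \<Rightarrow> complex) \<Rightarrow> complex" where
  "D_op C \<mu> \<delta> \<kappa> N f x =
     (\<Sum>i = 1..N. A_plus C \<mu> \<delta> \<kappa> N i x * (f (shift i \<delta> x) - f x)) +
     (\<Sum>i = 1..N. A_minus C \<mu> \<delta> \<kappa> N i x * (f (shift i (- \<delta>) x) - f x))"

definition Phi_quot ::
  "(complex \<Rightarrow> complex) \<Rightarrow> complex \<Rightarrow> complex \<Rightarrow> nat \<Rightarrow> nat \<Rightarrow>
   (nat \<Rightarrow> complex) \<Rightarrow> (nat \<Rightarrow> complex) \<Rightarrow> complex" where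
  "Phi_quot G \<delta> \<kappa> m n x y =
     (\<Prod>j = 1..m. \<Prod>l = 1..n. pm G (x j) (y l) ((\<delta> - \<kappa>) / 2) / pm G (x j) (y l) ((\<delta> + \<kappa>) / 2))"

definition Phi_prod ::
  "(complex \<Rightarrow> complex) \<Rightarrow> complex \<Rightarrow> complex \<Rightarrow> nat \<Rightarrow> nat \<Rightarrow>
   (nat \<Rightarrow> complex) \<Rightarrow> (nat \<Rightarrow> complex) \<Rightarrow> complex" where
  "Phi_prod G \<delta> \<kappa> m n x y =
     (\<Prod>j = 1..m. \<Prod>l = 1..n. \<Prod>\<epsilon>\<^sub>1\<in>{1, -1}. \<Prod>\<epsilon>\<^sub>2\<in>{1, -1}. G (\<epsilon>\<^sub>1 * x j + \<epsilon>\<^sub>2 * y l + (\<delta> - \<kappa>) / 2))"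

definition Psi ::
  "bc_case \<Rightarrow> nat \<Rightarrow> nat \<Rightarrow> (nat \<Rightarrow> complex) \<Rightarrow> (nat \<Rightarrow> complex) \<Rightarrow> complex" where
  "Psi C m n x y = (\<Prod>j = 1..m. \<Prod>l = 1..n. pm (br C) (x j) (y l) 0)"

text \<open>
  The identities of the theorem are between meromorphic functions of \<open>(x, y)\<close>. They are stated
  as equalities of values at every point at which all factors are defined, that is,
  no factor \<open>G\<close> is evaluated at a singularity and no denominator vanishes; division
  by zero and values at poles are arbitrary conventions of HOL. The excluded set is a locally finite
  union of affine hyperplanes, because all arguments are nonconstant affine functions of \<open>(x, y)\<close>
  and the zeros, poles and other non-analytic points of a nonzero meromorphic \<open>G\<close> are discrete.
\<close>

definition A_plus_defined :: "bc_case \<Rightarrow> complex \<Rightarrow> nat \<Rightarrow> nat \<Rightarrow> (nat \<Rightarrow> complex) \<Rightarrow> bool" where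
  "A_plus_defined C \<delta> N i x \<longleftrightarrow>
     (\<forall>s\<in>{1..rho C}. br C (x i - omega C s / 2) \<noteq> 0 \<and> br C (x i + (\<delta> - omega C s) / 2) \<noteq> 0) \<and>
     (\<forall>j\<in>{1..N} - {i}. pm (br C) (x i) (x j) 0 \<noteq> 0)"

text \<open>
  \<open>D_defined C \<delta> N P x\<close>: the value at \<open>x\<close> of the operator with shifts by \<open>\<plusminus>\<delta>\<close>, applied to a
  function whose points of definition are given by \<open>P\<close>, is defined.
\<close>

definition D_defined ::
  "bc_case \<Rightarrow> complex \<Rightarrow> nat \<Rightarrow> ((nat \<Rightarrow> complex) \<Rightarrow> bool) \<Rightarrow> (nat \<Rightarrow> complex) \<Rightarrow> bool" where
  "D_defined C \<delta> N P x \<longleftrightarrow>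
     P x \<and>
     (\<forall>i\<in>{1..N}. A_plus_defined C \<delta> N i x \<and> A_plus_defined C \<delta> N i (\<lambda>j. - x j) \<and>
                  P (shift i \<delta> x) \<and> P (shift i (- \<delta>) x))"

definition Phi_quot_defined ::
  "(complex \<Rightarrow> complex) \<Rightarrow> complex \<Rightarrow> complex \<Rightarrow> nat \<Rightarrow> nat \<Rightarrow>
   (nat \<Rightarrow> complex) \<Rightarrow> (nat \<Rightarrow> complex) \<Rightarrow> bool" where
  "Phi_quot_defined G \<delta> \<kappa> m n x y \<longleftrightarrow>
     (\<forall>j\<in>{1..m}. \<forall>l\<in>{1..n}. \<forall>\<epsilon>\<in>{1, -1}.
        G analytic_on {x j + \<epsilon> * y l + (\<delta> - \<kappa>) / 2} \<and>
        G analytic_on {x j + \<epsilon> * y l + (\<delta> + \<kappa>) / 2} \<and>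
        G (x j + \<epsilon> * y l + (\<delta> + \<kappa>) / 2) \<noteq> 0)"

definition Phi_prod_defined ::
  "(complex \<Rightarrow> complex) \<Rightarrow> complex \<Rightarrow> complex \<Rightarrow> nat \<Rightarrow> nat \<Rightarrow>
   (nat \<Rightarrow> complex) \<Rightarrow> (nat \<Rightarrow> complex) \<Rightarrow> bool" where
  "Phi_prod_defined G \<delta> \<kappa> m n x y \<longleftrightarrow>
     (\<forall>j\<in>{1..m}. \<forall>l\<in>{1..n}. \<forall>\<epsilon>\<^sub>1\<in>{1, -1}. \<forall>\<epsilon>\<^sub>2\<in>{1, -1}.
        G analytic_on {\<epsilon>\<^sub>1 * x j + \<epsilon>\<^sub>2 * y l + (\<delta> - \<kappa>) / 2})"

text \<open>
  A function in the sense of \<^term>\<open>G meromorphic_on UNIV\<close> may take arbitrary values on a discrete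
  set, so nonvanishing and the functional equation are required up to such a set.
\<close>

definition gamma_type :: "bc_case \<Rightarrow> complex \<Rightarrow> complex \<Rightarrow> (complex \<Rightarrow> complex) \<Rightarrow> bool" where
  "gamma_type C \<delta> c\<^sub>0 G \<longleftrightarrow>
     G meromorphic_on UNIV \<and>
     \<not> (\<forall>\<^sub>\<approx>u\<in>UNIV. G u = 0) \<and>
     (\<forall>\<^sub>\<approx>u\<in>UNIV. G (u + \<delta>) = c\<^sub>0 * br C u * G u)"

end

theory Submission
  imports Defs
begin

text \<open>
Write \<open>X(w) = \<Prod>\<^sub>j [w \<plusminus> x\<^sub>j + \<kappa>] / [w \<plusminus> x\<^sub>j]\<close> and
\<open>Y(w) = \<Prod>\<^sub>l [w \<plusminus> y\<^sub>l + \<alpha> + \<beta>] / [w \<plusminus> y\<^sub>l + \<alpha>]\<close> with \<open>2\<alpha> + \<beta> = \<delta>\<close>. The choice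
\<open>\<alpha> = (\<delta> + \<kappa>)/2\<close>, \<open>\<beta> = -\<kappa>\<close> belongs to the two kernels \<open>\<Phi>\<close>, the choice \<open>\<alpha> = 0\<close>, \<open>\<beta> = \<delta>\<close> to \<open>\<Psi>\<close>.
Shifting \<open>x\<^sub>i\<close> by \<open>\<plusminus>\<delta>\<close> multiplies the kernel by \<open>Y(\<plusminus>x\<^sub>i)\<close>, and shifting \<open>y\<^sub>l\<close> multiplies it by the
value of \<open>X\<close> at one of the points \<open>\<plusminus>y\<^sub>l - \<alpha>\<close>. Hence, up to a common constant, the left-hand side divided by the
kernel is the sum of the residues at \<open>\<plusminus>x\<^sub>i\<close> and \<open>\<plusminus>y\<^sub>l - \<alpha>\<close> of the single function
\<open>H(w) = \<Prod>\<^sub>s [w + \<mu>\<^sub>s] (X(w) - 1) (Y(w) - 1) / ([2w + \<kappa>] [2w + \<delta>])\<close>.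

These points are all the poles of \<open>H\<close>: since
\<open>[w \<plusminus> v + c + d] - [w \<plusminus> v + c] = [2w + 2c + d] [d]\<close> (\<open>pm_increment\<close>), \<open>X - 1\<close> vanishes at the zeros of
\<open>[2w + \<kappa>]\<close> and \<open>Y - 1\<close> at those of \<open>[2w + \<delta>]\<close>. In the rational case \<open>H\<close> is \<open>O(w\<^sup>-\<^sup>2)\<close>, so the residues
add up to \<open>0\<close>. In the trigonometric case \<open>H\<close> is a rational function of \<open>z = exp(2\<pi>iw/\<omega>\<^sub>1)\<close>, regular at
\<open>0\<close> and at infinity, and the residues add up to the difference of its two limits, which is the
product of three brackets on the right-hand side. This is \<open>source_identity\<close>. The residue theorem appears
there in its algebraic form, Lagrange interpolation (\<open>lagrange_leading_coeff\<close>): after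
multiplication by its denominators \<open>H\<close> becomes a polynomial of controlled degree, because the divisions
by \<open>[2w + \<kappa>]\<close> and \<open>[2w + \<delta>]\<close> can be carried out explicitly by a telescoping sum.

The argument needs the points \<open>\<plusminus>x\<^sub>i\<close> and \<open>\<plusminus>y\<^sub>l - \<alpha>\<close> to be distinct modulo the period, and for the kernels \<open>\<Phi>\<close> also
the functional equation of \<open>G\<close> at all relevant arguments, which holds only outside a discrete set. Both
hold at \<open>(x + t, y)\<close> for all small \<open>t \<noteq> 0\<close>, where \<open>x + t\<close> adds \<open>t\<close> to every coordinate. The two sides are continuous in \<open>t\<close>
wherever their factors are defined, so that the identity follows at \<open>t = 0\<close>.
\<close>

section \<open>Lagrange interpolation and telescoping\<close>

text \<open>
Both sides are the coefficient of the highest power in the Lagrange interpolation polynomial of \<open>P\<close> on \<open>S\<close>,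
which is \<open>P\<close> itself. Equivalently, the residues of \<open>P(w) / \<Prod>\<^sub>b (w - b)\<close> add up to its coefficient of
\<open>1/w\<close> at infinity.
\<close>

lemma lagrange_leading_coeff:
  fixes S :: "complex set"
  assumes "finite S" "degree P < card S"
  shows "(\<Sum>a\<in>S. poly P a / (\<Prod>b\<in>S - {a}. a - b)) = coeff P (card S - 1)"
proof -
  define L where "L a = (\<Prod>b\<in>S - {a}. [:- b, 1:])" for a :: complex
  have degL: "degree (L a) = card S - 1" and coL: "coeff (L a) (card S - 1) = 1" if "a \<in> S" for a
  proof -
    show d: "degree (L a) = card S - 1"
      unfolding L_def using assms that by (subst degree_prod_eq_sum_degree) auto
    have "lead_coeff (L a) = 1" unfolding L_def lead_coeff_prod by simp
    then show "coeff (L a) (card S - 1) = 1" by (simp add: d)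
  qed
  have polyL: "poly (L a) b = (if b = a then \<Prod>b\<in>S - {a}. a - b else 0)" if "b \<in> S" for a b
    using assms that by (auto simp: L_def poly_prod intro!: prod.cong)
  define Q where "Q = (\<Sum>a\<in>S. smult (poly P a / (\<Prod>b\<in>S - {a}. a - b)) (L a))"
  \<comment> \<open>\<open>Q\<close> is the interpolation polynomial; it agrees with \<open>P\<close> at as many points as the degrees allow.\<close>
  have "poly Q a = poly P a" if "a \<in> S" for a
  proof -
    have "poly Q a = (\<Sum>b\<in>S. if a = b then poly P a else 0)"
      unfolding Q_def poly_sum poly_smult
      by (rule sum.cong[OF refl]) (use assms that in \<open>auto simp: polyL prod_zero_iff\<close>)
    then show ?thesis using that assms by simp
  qed
  moreover have "degree Q \<le> card S - 1" unfolding Q_def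
    by (rule degree_sum_le) (use assms degL in \<open>auto intro: order.trans[OF degree_smult_le]\<close>)
  ultimately have "P = Q"
    using assms by (intro poly_eqI_degree[of S]) auto
  then have "coeff P (card S - 1) = coeff Q (card S - 1)" by simp
  also have "\<dots> = (\<Sum>a\<in>S. poly P a / (\<Prod>b\<in>S - {a}. a - b))"
    unfolding Q_def coeff_sum coeff_smult by (rule sum.cong) (use coL in auto)
  finally show ?thesis by simp
qed

text \<open>
The quotient \<open>(\<Prod>\<^sub>j (g\<^sub>j + t) - \<Prod>\<^sub>j g\<^sub>j) / t\<close>, written without a division so that it also makes sense
for \<open>t = 0\<close> and stays polynomial when \<open>g\<close> and \<open>t\<close> depend polynomially on a variable.
\<close>

fun telescope :: "nat \<Rightarrow> (nat \<Rightarrow> 'a) \<Rightarrow> 'a \<Rightarrow> 'a::comm_ring_1" where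
  "telescope 0 g t = 0"
| "telescope (Suc n) g t = telescope n g t * (g (Suc n) + t) + (\<Prod>j = 1..n. g j)"

lemma telescope_mult:
  "t * telescope n g t = (\<Prod>j = 1..n. g j + t) - (\<Prod>j = 1..n. g j)"
proof (induction n)
  case (Suc n)
  have "t * telescope (Suc n) g t = (t * telescope n g t) * (g (Suc n) + t) + t * (\<Prod>j = 1..n. g j)"
    by (simp add: algebra_simps)
  then show ?case unfolding Suc by (simp add: algebra_simps)
qed simp

text \<open>
For \<open>t \<noteq> 0\<close> this is a division of the previous identity by \<open>t\<close>. Induction on the recursion gives it for
\<open>t = 0\<close> as well, which covers the nodes with \<open>[2x\<^sub>i + \<kappa>] = 0\<close>.
\<close>

lemma telescope_at_zero:
  assumes "i \<in> {1..n}" "g i = 0"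
  shows "telescope n g t = (\<Prod>j\<in>{1..n} - {i}. g j + t)"
  using assms
proof (induction n)
  case (Suc n)
  show ?case
  proof (cases "i = Suc n")
    case True
    then have "{1..Suc n} - {i} = {1..n}" by auto
    then show ?thesis using Suc.prems True telescope_mult[of t n g] by (simp add: algebra_simps)
  next
    case False
    then have i: "i \<in> {1..n}" using Suc.prems by auto
    have "{1..Suc n} - {i} = insert (Suc n) ({1..n} - {i})" using False by auto
    moreover have "(\<Prod>j = 1..n. g j) = 0" by (rule prod_zero) (use i Suc.prems in auto)
    ultimately show ?thesis using Suc i by (simp add: mult.commute)
  qed
qed simp

section \<open>The bracket\<close>

lemma br_minus [simp]: "br C (- u) = - br C u"
  by (cases C) auto

lemma br_0 [simp]: "br C 0 = 0"
  by (cases C) auto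

declare br.simps [simp del]

text \<open>
Since \<open>[a \<plusminus> b] = [a]\<^sup>2 - [b]\<^sup>2\<close>, the difference of the two \<open>pm\<close> terms is \<open>[w + c + d]\<^sup>2 - [w + c]\<^sup>2\<close>, which factors
again by the same formula. It is independent of \<open>v\<close>, the fact that makes \<open>X - 1\<close> divisible by \<open>[2w + \<kappa>]\<close>.
\<close>

lemma pm_increment: "pm (br C) w v (c + d) = pm (br C) w v c + br C (2 * w + 2 * c + d) * br C d"
proof (cases C)
  case (Trigonometric p)
  define A B D where "A = of_real pi * (w + c) / p" and "B = of_real pi * v / p" and "D = of_real pi * d / p"
  have e: "of_real pi * (w + v + (c + d)) / p = A + B + D" "of_real pi * (w - v + (c + d)) / p = A - B + D"
    "of_real pi * (w + v + c) / p = A + B" "of_real pi * (w - v + c) / p = A - B"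
    "of_real pi * (2 * w + 2 * c + d) / p = A + A + D"
    by (auto simp: A_def B_def D_def add_divide_distrib diff_divide_distrib algebra_simps)
  have i: "2 * \<i> * s * (2 * \<i> * s') = - 4 * (s * s')" for s s' by (simp add: algebra_simps)
  have k: "sin (A + B + D) * sin (A - B + D) = sin (A + B) * sin (A - B) + sin (A + A + D) * sin D"
    unfolding sin_times_sin by (simp add: algebra_simps diff_divide_distrib[symmetric] add_divide_distrib[symmetric])
  show ?thesis
    unfolding pm_def Trigonometric br.simps e D_def[symmetric] i k by (simp add: algebra_simps)
next
  case Rational
  then show ?thesis by (simp add: pm_def br.simps algebra_simps)
qed

lemma prod_signed_nodes:
  fixes h :: "complex \<times> 'a \<Rightarrow> complex"
  assumes "finite I"
  shows "(\<Prod>p\<in>{1,-1} \<times> I. h p) = (\<Prod>j\<in>I. h (1, j) * h (-1, j))"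
proof -
  have "(\<Prod>p\<in>{1,-1} \<times> I. h p) = (\<Prod>\<sigma>\<in>{1,-1}. \<Prod>j\<in>I. h (\<sigma>, j))"
    by (simp add: prod.cartesian_product)
  then show ?thesis using assms by (simp add: prod.distrib)
qed

lemma sum_signed_nodes:
  fixes h :: "complex \<times> 'a \<Rightarrow> complex"
  assumes "finite I"
  shows "(\<Sum>p\<in>{1,-1} \<times> I. h p) = (\<Sum>j\<in>I. h (1, j)) + (\<Sum>j\<in>I. h (-1, j))"
proof -
  have "(\<Sum>p\<in>{1,-1} \<times> I. h p) = (\<Sum>\<sigma>\<in>{1,-1}. \<Sum>j\<in>I. h (\<sigma>, j))"
    by (simp add: sum.cartesian_product)
  then show ?thesis using assms by (simp add: sum.distrib)
qed

lemma prod_signed_nodes_except: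
  fixes h :: "complex \<times> 'a \<Rightarrow> complex"
  assumes "finite I" "i \<in> I" "\<sigma> \<in> {1,-1}"
  shows "(\<Prod>p\<in>{1,-1} \<times> I - {(\<sigma>, i)}. h p) = h (- \<sigma>, i) * (\<Prod>j\<in>I - {i}. h (1, j) * h (-1, j))"
proof -
  have "{1,-1} \<times> I - {(\<sigma>, i)} = insert (- \<sigma>, i) ({1,-1} \<times> (I - {i}))"
    using assms by auto
  then have "(\<Prod>p\<in>{1,-1} \<times> I - {(\<sigma>, i)}. h p) = h (- \<sigma>, i) * (\<Prod>p\<in>{1,-1} \<times> (I - {i}). h p)"
    using assms by (simp only:) (subst prod.insert, auto)
  also have "(\<Prod>p\<in>{1,-1} \<times> (I - {i}). h p) = (\<Prod>j\<in>I - {i}. h (1, j) * h (-1, j))"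
    by (rule prod_signed_nodes) (use assms in auto)
  finally show ?thesis .
qed

section \<open>Sums over nodes\<close>

text \<open>
The square of \<open>qe p w\<close> is the coordinate \<open>z = exp(2\<pi>iw/p)\<close>; the square root itself is needed
because the bracket has half-integer exponents in \<open>z\<close>.
\<close>

definition qe :: "complex \<Rightarrow> complex \<Rightarrow> complex" where
  "qe p u = exp (\<i> * of_real pi * u / p)"

lemma qe_nonzero [simp]: "qe p u \<noteq> 0" by (simp add: qe_def)
lemma qe_0 [simp]: "qe p 0 = 1" by (simp add: qe_def)
lemma qe_add: "qe p (u + v) = qe p u * qe p v"
  by (simp add: qe_def add_divide_distrib distrib_left exp_add)
lemma qe_minus: "qe p (- u) = inverse (qe p u)"
  by (simp add: qe_def exp_minus)
lemma qe_diff: "qe p (u - v) = qe p u / qe p v"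
  using qe_add[of p u "- v"] by (simp add: qe_minus divide_inverse)
lemma qe_sum: "qe p (\<Sum>k\<in>K. z k) = (\<Prod>k\<in>K. qe p (z k))"
  by (induction K rule: infinite_finite_induct) (auto simp: qe_add)
lemma br_qe: "br (Trigonometric p) u = qe p u - inverse (qe p u)"
  unfolding qe_minus[symmetric] by (simp add: qe_def br.simps sin_exp_eq mult.assoc diff_divide_distrib algebra_simps)

text \<open>
\<open>f\<close> is a Laurent polynomial in \<open>qe p w\<close> with exponents \<open>-N, -N + 2, \<dots>, N\<close>; \<open>a\<close> and \<open>b\<close> are its extreme
coefficients, which govern the behaviour of \<open>f\<close> at the two ends of the period strip.
\<close>

definition trig_poly :: "complex \<Rightarrow> nat \<Rightarrow> complex \<Rightarrow> complex \<Rightarrow> (complex \<Rightarrow> complex) \<Rightarrow> bool" where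
  "trig_poly p N a b f \<longleftrightarrow> (\<exists>P. degree P \<le> N \<and> coeff P N = a \<and> coeff P 0 = b \<and>
     (\<forall>w. f w * qe p w ^ N = poly P ((qe p w)\<^sup>2)))"

lemma trig_poly_const: "trig_poly p 0 a a (\<lambda>w. a)"
  unfolding trig_poly_def by (rule exI[of _ "[:a:]"]) auto

lemma trig_poly_br: "trig_poly p 1 (qe p c) (- inverse (qe p c)) (\<lambda>w. br (Trigonometric p) (w + c))"
  unfolding trig_poly_def
  by (rule exI[of _ "[:- inverse (qe p c), qe p c:]"])
     (auto simp: br_qe qe_add field_simps power2_eq_square)

lemma trig_poly_add:
  assumes "trig_poly p N a b f" "trig_poly p N a' b' g"
  shows "trig_poly p N (a + a') (b + b') (\<lambda>w. f w + g w)"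
proof -
  from assms obtain P P' where
    "degree P \<le> N \<and> coeff P N = a \<and> coeff P 0 = b \<and> (\<forall>w. f w * qe p w ^ N = poly P ((qe p w)\<^sup>2))"
    "degree P' \<le> N \<and> coeff P' N = a' \<and> coeff P' 0 = b' \<and> (\<forall>w. g w * qe p w ^ N = poly P' ((qe p w)\<^sup>2))"
    unfolding trig_poly_def by blast
  then show ?thesis unfolding trig_poly_def
    by (intro exI[of _ "P + P'"]) (auto intro: degree_add_le simp: distrib_right)
qed

lemma trig_poly_mult:
  assumes "trig_poly p N a b f" "trig_poly p N' a' b' g"
  shows "trig_poly p (N + N') (a * a') (b * b') (\<lambda>w. f w * g w)"
proof -
  from assms obtain P P' where
    P: "degree P \<le> N" "coeff P N = a" "coeff P 0 = b" "\<And>w. f w * qe p w ^ N = poly P ((qe p w)\<^sup>2)" and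
    P': "degree P' \<le> N'" "coeff P' N' = a'" "coeff P' 0 = b'" "\<And>w. g w * qe p w ^ N' = poly P' ((qe p w)\<^sup>2)"
    unfolding trig_poly_def by blast
  have deg: "degree (P * P') \<le> N + N'"
    using degree_mult_le[of P P'] P(1) P'(1) by linarith
  have "coeff (P * P') (N + N') = coeff P N * coeff P' N'"
  proof (cases "degree P = N \<and> degree P' = N'")
    case True
    then show ?thesis using coeff_mult_degree_sum[of P P'] by simp
  next
    case False
    then have "degree P < N \<or> degree P' < N'" using P(1) P'(1) by linarith
    moreover from this have "degree (P * P') < N + N'"
      using degree_mult_le[of P P'] P(1) P'(1) by linarith
    ultimately show ?thesis by (auto simp: coeff_eq_0)
  qed
  moreover have "f w * g w * qe p w ^ (N + N') = poly (P * P') ((qe p w)\<^sup>2)" for w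
    unfolding poly_mult P(4)[of w, symmetric] P'(4)[of w, symmetric] by (simp add: power_add mult_ac)
  moreover have "coeff (P * P') 0 = b * b'" using P P' by (simp add: coeff_mult)
  ultimately show ?thesis unfolding trig_poly_def using deg P P' by (intro exI[of _ "P * P'"]) auto
qed

lemma trig_poly_pm:
  "trig_poly p 2 ((qe p c)\<^sup>2) (inverse ((qe p c)\<^sup>2)) (\<lambda>w. pm (br (Trigonometric p)) w v c)"
proof -
  have e: "pm (br (Trigonometric p)) w v c =
      br (Trigonometric p) (w + (v + c)) * br (Trigonometric p) (w + (c - v))" for w
    by (simp add: pm_def algebra_simps)
  have "qe p (v + c) * qe p (c - v) = (qe p c)\<^sup>2"
    "(- inverse (qe p (v + c))) * (- inverse (qe p (c - v))) = inverse ((qe p c)\<^sup>2)"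
    by (auto simp: qe_add qe_diff power2_eq_square field_simps)
  then show ?thesis
    using trig_poly_mult[OF trig_poly_br[of p "v + c"] trig_poly_br[of p "c - v"]]
    by (simp only: e one_add_one)
qed

lemma trig_poly_prod_pm:
  "trig_poly p (2 * n) (qe p c ^ (2 * n)) (inverse (qe p c ^ (2 * n)))
     (\<lambda>w. \<Prod>j = 1..n. pm (br (Trigonometric p)) w (v j) c)"
proof (induction n)
  case 0
  show ?case using trig_poly_const[of p 1] by simp
next
  case (Suc n)
  show ?case using trig_poly_mult[OF Suc trig_poly_pm[of p c "v (Suc n)"]]
    by (simp add: power2_eq_square mult_ac)
qed

lemma residue_quotient_aux:
  fixes B :: complex
  assumes "B * q * Q = e * E" "B \<noteq> 0" "f * q = P" "Q \<noteq> 0" "e \<noteq> 0"  "q \<noteq> 0"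
  shows "f / B = Q * (P / (e * E))"
proof -
  have "Q * (P / (e * E)) = (Q * q) * f / ((Q * q) * B)"
    using assms(1,3) by (simp add: mult_ac)
  then show ?thesis using assms(4,6) by simp
qed

text \<open>
In the coordinate \<open>z\<close> the summands are residues of \<open>P(z) / (z \<Prod>\<^sub>k (z - e\<^sub>k))\<close> at the nodes \<open>e\<^sub>k\<close>, where
\<open>e\<^sub>k\<close> is the value of \<open>z\<close> at the \<open>k\<close>th point. The factor \<open>1/z\<close> comes from the differential \<open>dz/z\<close> and adds the node \<open>0\<close>,
whose contribution is the term with \<open>b\<close>.
\<close>

lemma trig_node_sum:
  fixes z :: "'k \<Rightarrow> complex"
  assumes f: "trig_poly p (card K) a b f" and "finite K" "even (card K)"
    and nz: "\<And>k l. k \<in> K \<Longrightarrow> l \<in> K \<Longrightarrow> k \<noteq> l \<Longrightarrow> br (Trigonometric p) (z k - z l) \<noteq> 0"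
  shows "(\<Sum>k\<in>K. f (z k) / (\<Prod>l\<in>K - {k}. br (Trigonometric p) (z k - z l))) =
    a * qe p (\<Sum>k\<in>K. z k) - b * inverse (qe p (\<Sum>k\<in>K. z k))"
proof -
  define N where "N = card K"
  obtain P where P: "degree P \<le> N" "coeff P N = a" "coeff P 0 = b"
      "\<And>w. f w * qe p w ^ N = poly P ((qe p w)\<^sup>2)"
    using f unfolding trig_poly_def N_def by blast
  define e where "e k = (qe p (z k))\<^sup>2" for k
  define Q where "Q = (\<Prod>k\<in>K. qe p (z k))"
  have Q0: "Q \<noteq> 0" using assms by (simp add: Q_def)
  have br_e: "br (Trigonometric p) (z k - z l) * (qe p (z k) * qe p (z l)) = e k - e l" for k l
    by (simp add: br_qe qe_diff e_def power2_eq_square field_simps)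
  have inj: "inj_on e K"
  proof (rule inj_onI, rule ccontr)
    fix k l assume "k \<in> K" "l \<in> K" "e k = e l" "k \<noteq> l"
    then show False using br_e[of k l] nz[of k l] by simp
  qed
  have e0: "e k \<noteq> 0" for k by (simp add: e_def)
  have summand: "f (z k) / (\<Prod>l\<in>K - {k}. br (Trigonometric p) (z k - z l)) =
    Q * (poly P (e k) / (e k * (\<Prod>l\<in>K - {k}. e k - e l)))" if k: "k \<in> K" for k
  proof -
    let ?B = "\<Prod>l\<in>K - {k}. br (Trigonometric p) (z k - z l)"
    have "?B * (qe p (z k) ^ (card (K - {k})) * (\<Prod>l\<in>K - {k}. qe p (z l))) = (\<Prod>l\<in>K - {k}. e k - e l)"
      by (simp add: br_e[symmetric] prod.distrib)
    moreover have "Q = qe p (z k) * (\<Prod>l\<in>K - {k}. qe p (z l))"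
      unfolding Q_def using assms(2) k by (rule prod.remove)
    moreover have "qe p (z k) ^ N = qe p (z k) * qe p (z k) ^ (card (K - {k}))"
      using assms(2) k unfolding N_def by (metis card_Suc_Diff1 power_Suc)
    ultimately have "?B * qe p (z k) ^ N * Q = e k * (\<Prod>l\<in>K - {k}. e k - e l)"
      by (simp add: e_def power2_eq_square mult_ac)
    moreover have "?B \<noteq> 0" using assms(2) nz[OF k] by (auto simp: prod_zero_iff)
    moreover have "f (z k) * qe p (z k) ^ N = poly P (e k)" unfolding e_def by (rule P(4))
    ultimately show ?thesis using Q0 e0[of k] by (intro residue_quotient_aux[where q = "qe p (z k) ^ N"]) auto
  qed
  \<comment> \<open>The interpolation nodes are the \<open>e k\<close> together with the pole \<open>0\<close> of \<open>dz/z\<close>.\<close>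
  define S where "S = insert 0 (e ` K)"
  have cS: "card S = Suc N" "0 \<notin> e ` K" using assms(2) inj e0
    by (auto simp: S_def N_def card_insert_if card_image)
  have fS: "finite S" using assms(2) by (simp add: S_def)
  have p0: "(\<Prod>l\<in>S - {0}. 0 - l) = Q\<^sup>2"
  proof -
    have "(\<Prod>l\<in>S - {0}. 0 - l) = (\<Prod>k\<in>K. - e k)"
      using cS(2) by (simp add: S_def prod.reindex[OF inj])
    also have "\<dots> = (\<Prod>k\<in>K. e k)" using assms(3) by (simp add: prod_uminus)
    finally show ?thesis by (simp add: e_def Q_def prod_power_distrib)
  qed
  have pk: "(\<Prod>b\<in>S - {e k}. e k - b) = e k * (\<Prod>l\<in>K - {k}. e k - e l)" if k: "k \<in> K" for k
  proof -
    have "S - {e k} = insert 0 (e ` (K - {k}))" using k inj e0 by (auto simp: S_def inj_on_def)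
    moreover have "0 \<notin> e ` (K - {k})" using cS(2) by auto
    moreover have "inj_on e (K - {k})" using inj by (rule inj_on_subset) auto
    ultimately show ?thesis using assms(2) by (simp add: prod.reindex)
  qed
  have "coeff P N = (\<Sum>s\<in>S. poly P s / (\<Prod>b\<in>S - {s}. s - b))"
    using lagrange_leading_coeff[of S P] P(1) fS cS by simp
  also have "\<dots> = poly P 0 / Q\<^sup>2 + (\<Sum>k\<in>K. poly P (e k) / (\<Prod>b\<in>S - {e k}. e k - b))"
    using cS(2) assms(2) inj p0 unfolding S_def by (simp add: sum.reindex)
  also have "\<dots> = b / Q\<^sup>2 + (\<Sum>k\<in>K. poly P (e k) / (e k * (\<Prod>l\<in>K - {k}. e k - e l)))"
    using P(3) by (simp add: pk poly_0_coeff_0)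
  finally have eq: "a = b / Q\<^sup>2 + (\<Sum>k\<in>K. poly P (e k) / (e k * (\<Prod>l\<in>K - {k}. e k - e l)))"
    using P(2) by simp
  have "(\<Sum>k\<in>K. f (z k) / (\<Prod>l\<in>K - {k}. br (Trigonometric p) (z k - z l))) =
    Q * (\<Sum>k\<in>K. poly P (e k) / (e k * (\<Prod>l\<in>K - {k}. e k - e l)))"
    by (simp add: summand sum_distrib_left)
  also have "\<dots> = Q * (a - b / Q\<^sup>2)" using eq by simp
  also have "\<dots> = a * Q - b * inverse Q" using Q0 by (simp add: field_simps power2_eq_square)
  finally show ?thesis by (simp add: Q_def qe_sum)
qed

lemma rational_node_sum:
  fixes z :: "'k \<Rightarrow> complex"
  assumes "degree P + 1 < card K \<or> P = 0" "finite K" "inj_on z K"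
  shows "(\<Sum>k\<in>K. poly P (z k) / (\<Prod>l\<in>K - {k}. z k - z l)) = 0"
proof (cases "P = 0")
  case False
  have c: "card (z ` K) = card K" using assms by (simp add: card_image)
  have "(\<Prod>b\<in>z ` K - {z k}. z k - b) = (\<Prod>l\<in>K - {k}. z k - z l)" if "k \<in> K" for k
  proof -
    have "z ` K - {z k} = z ` (K - {k})" using that assms(3) by (auto simp: inj_on_def)
    moreover have "inj_on z (K - {k})" using assms(3) by (rule inj_on_subset) auto
    ultimately show ?thesis by (simp add: prod.reindex)
  qed
  then have "(\<Sum>k\<in>K. poly P (z k) / (\<Prod>l\<in>K - {k}. z k - z l)) = coeff P (card K - 1)"
    using lagrange_leading_coeff[of "z ` K" P] assms False c by (simp add: sum.reindex)
  also have "\<dots> = 0" using assms False by (intro coeff_eq_0) auto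
  finally show ?thesis .
qed simp

section \<open>Division by the duplicated bracket\<close>

text \<open>
This is \<open>(\<Prod>\<^sub>j [w \<plusminus> v\<^sub>j + c + d] - \<Prod>\<^sub>j [w \<plusminus> v\<^sub>j + c]) / [2w + 2c + d]\<close>. With \<open>c = 0\<close>, \<open>d = \<kappa>\<close> it is \<open>(X - 1) / [2w + \<kappa>]\<close>
times the denominator of \<open>X\<close>, and with \<open>c = \<alpha>\<close>, \<open>d = \<beta>\<close> it is the analogue for \<open>Y\<close>.
\<close>

definition telescoped_quot :: "bc_case \<Rightarrow> nat \<Rightarrow> (nat \<Rightarrow> complex) \<Rightarrow> complex \<Rightarrow> complex \<Rightarrow> complex \<Rightarrow> complex" where
  "telescoped_quot C n v c d w =
     br C d * telescope n (\<lambda>j. pm (br C) w (v j) c) (br C (2 * w + 2 * c + d) * br C d)"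

lemma telescoped_quot_mult:
  "br C (2 * w + 2 * c + d) * telescoped_quot C n v c d w =
     (\<Prod>j = 1..n. pm (br C) w (v j) (c + d)) - (\<Prod>j = 1..n. pm (br C) w (v j) c)"
  using telescope_mult[of "br C (2 * w + 2 * c + d) * br C d" n "\<lambda>j. pm (br C) w (v j) c"]
  unfolding telescoped_quot_def pm_increment by (simp add: mult.assoc)

lemma telescoped_quot_at_node:
  assumes "i \<in> {1..n}" "pm (br C) w (v i) c = 0"
  shows "telescoped_quot C n v c d w = br C d * (\<Prod>j\<in>{1..n} - {i}. pm (br C) w (v j) (c + d))"
  unfolding telescoped_quot_def pm_increment using telescope_at_zero[where g="\<lambda>j. pm (br C) w (v j) c", OF assms]
  by simp

lemma telescoped_quot_Suc:
  "telescoped_quot C (Suc n) v c d w = telescoped_quot C n v c d w * pm (br C) w (v (Suc n)) (c + d) +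
     br C d * (\<Prod>j = 1..n. pm (br C) w (v j) c)"
  by (simp add: telescoped_quot_def pm_increment[of C w "v (Suc n)" c d] algebra_simps)

lemma qe_of_nat: "qe p (of_nat n * u) = qe p u ^ n"
  by (induction n) (auto simp: distrib_right qe_add)

text \<open>
The quotient has exponents between \<open>-(2n - 2)\<close> and \<open>2n - 2\<close>. It is multiplied by some \<open>B\<close> of degree \<open>2\<close> here so
that the case \<open>n = 0\<close>, where the quotient vanishes, fits the same pattern. The extreme
coefficients come from those of \<open>\<Prod>\<^sub>j [w \<plusminus> v\<^sub>j + c + d] - \<Prod>\<^sub>j [w \<plusminus> v\<^sub>j + c]\<close>, namely \<open>q(\<plusminus>2n(c + d)) - q(\<plusminus>2nc)\<close> with \<open>q = qe p\<close>,
after division by those of \<open>[2w + 2c + d]\<close>.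
\<close>

lemma trig_poly_telescoped_quot:
  assumes B: "trig_poly p 2 a b B"
  shows "trig_poly p (2 * n)
      (a * (br (Trigonometric p) (of_nat n * d) * qe p (of_nat n * (2 * c + d) - (2 * c + d))))
      (b * (br (Trigonometric p) (of_nat n * d) * inverse (qe p (of_nat n * (2 * c + d) - (2 * c + d)))))
      (\<lambda>w. B w * telescoped_quot (Trigonometric p) n v c d w)"
proof (induction n)
  case 0
  show ?case using trig_poly_const[of p 0] by (simp add: telescoped_quot_def)
next
  case (Suc n)
  let ?C = "Trigonometric p"
  define r t where "r = qe p c" and "t = qe p d"
  have rt: "r \<noteq> 0" "t \<noteq> 0" by (auto simp: r_def t_def)
  have top: "br ?C (of_nat n * d) * qe p (of_nat n * (2 * c + d) - (2 * c + d)) * (qe p (c + d))\<^sup>2 +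
      br ?C d * qe p c ^ (2 * n) =
      br ?C (of_nat (Suc n) * d) * qe p (of_nat (Suc n) * (2 * c + d) - (2 * c + d))"
    unfolding br_qe qe_diff qe_of_nat qe_add mult_2 r_def[symmetric] t_def[symmetric]
    using rt by (simp add: field_simps power_add power_mult_distrib power2_eq_square power_mult)
  have bot: "br ?C (of_nat n * d) * inverse (qe p (of_nat n * (2 * c + d) - (2 * c + d))) * inverse ((qe p (c + d))\<^sup>2) +
      br ?C d * inverse (qe p c ^ (2 * n)) =
      br ?C (of_nat (Suc n) * d) * inverse (qe p (of_nat (Suc n) * (2 * c + d) - (2 * c + d)))"
    unfolding br_qe qe_diff qe_of_nat qe_add mult_2 r_def[symmetric] t_def[symmetric]
    using rt by (simp add: field_simps power_add power_mult_distrib power2_eq_square power_mult)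
  have 1: "trig_poly p (2 * n + 2)
      (a * (br ?C (of_nat n * d) * qe p (of_nat n * (2 * c + d) - (2 * c + d))) * (qe p (c + d))\<^sup>2)
      (b * (br ?C (of_nat n * d) * inverse (qe p (of_nat n * (2 * c + d) - (2 * c + d)))) * inverse ((qe p (c + d))\<^sup>2))
      (\<lambda>w. B w * telescoped_quot ?C n v c d w * pm (br ?C) w (v (Suc n)) (c + d))"
    by (rule trig_poly_mult[OF Suc trig_poly_pm])
  have 2: "trig_poly p (2 * n + 2)
      (br ?C d * (qe p c ^ (2 * n) * a)) (br ?C d * (inverse (qe p c ^ (2 * n)) * b))
      (\<lambda>w. br ?C d * ((\<Prod>j = 1..n. pm (br ?C) w (v j) c) * B w))"
    using trig_poly_mult[OF trig_poly_const[of p "br ?C d"] trig_poly_mult[OF trig_poly_prod_pm B]] by simp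
  have a: "a * X * Y + e * (Z * a) = a * (X * Y + e * Z)" for a X Y Z e :: complex
    by (simp add: algebra_simps)
  have w: "(\<lambda>w. B w * telescoped_quot ?C n v c d w * pm (br ?C) w (v (Suc n)) (c + d) +
      br ?C d * ((\<Prod>j = 1..n. pm (br ?C) w (v j) c) * B w)) = (\<lambda>w. B w * telescoped_quot ?C (Suc n) v c d w)"
    by (rule ext) (simp add: telescoped_quot_Suc algebra_simps)
  have N: "2 * n + 2 = 2 * Suc n" by simp
  show ?case using trig_poly_add[OF 1 2] unfolding w unfolding a top bot N .
qed

text \<open>
The rational counterpart. In the difference of the two products the terms of degree \<open>2n\<close> cancel, so the
quotient has degree at most \<open>2n - 2\<close>; again a factor \<open>B\<close>, here linear, absorbs the case \<open>n = 0\<close>.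
\<close>

lemma rational_telescoped_quot:
  assumes "degree B \<le> 1"
  shows "\<exists>P. (P = 0 \<or> degree P < 2 * n) \<and> (\<forall>w. poly B w * telescoped_quot Rational n v c d w = poly P w)"
proof (induction n)
  case 0
  show ?case by (rule exI[of _ 0]) (simp add: telescoped_quot_def)
next
  case (Suc n)
  then obtain P where P: "P = 0 \<or> degree P < 2 * n" "\<And>w. poly B w * telescoped_quot Rational n v c d w = poly P w"
    by blast
  define g where "g u e = [:u + e, 1:] * [:e - u, 1:]" for u e :: complex
  have g: "pm (br Rational) w u e = poly (g u e) w" for w u e
    by (simp add: g_def pm_def br.simps algebra_simps)
  have dg: "degree (g u e) \<le> 2" for u e
    unfolding g_def by (rule order.trans[OF degree_mult_le]) auto
  define Q where "Q = P * g (v (Suc n)) (c + d) + smult d (B * (\<Prod>j = 1..n. g (v j) c))"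
  have "degree (\<Prod>j = 1..n. g (v j) c) \<le> (\<Sum>j = 1..n. degree (g (v j) c))"
    using degree_prod_sum_le[of "{1..n}" "\<lambda>j. g (v j) c"] by (simp add: o_def)
  also have "\<dots> \<le> (\<Sum>j = 1..n. 2)" by (rule sum_mono) (rule dg)
  finally have "degree (B * (\<Prod>j = 1..n. g (v j) c)) < 2 * Suc n"
    using degree_mult_le[of B "\<Prod>j = 1..n. g (v j) c"] assms by simp
  then have "degree (smult d (B * (\<Prod>j = 1..n. g (v j) c))) < 2 * Suc n"
    using degree_smult_le le_less_trans by blast
  moreover have "degree (P * g (v (Suc n)) (c + d)) < 2 * Suc n"
    using P(1) degree_mult_le[of P "g (v (Suc n)) (c + d)"] dg[of "v (Suc n)" "c + d"] by auto
  ultimately have "degree Q < 2 * Suc n" unfolding Q_def by (rule degree_add_less[rotated])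
  moreover have "poly B w * telescoped_quot Rational (Suc n) v c d w = poly Q w" for w
    unfolding telescoped_quot_Suc Q_def g poly_add poly_mult poly_smult poly_prod P(2)[symmetric] br.simps
    by (simp add: algebra_simps)
  ultimately show ?case by blast
qed

section \<open>Residues at the signed nodes\<close>

text \<open>
The two groups of variables enter symmetrically: \<open>(v, c, d, m)\<close> and \<open>(v', c', d', n)\<close> describe the blocks
\<open>\<Prod>\<^sub>j [w \<plusminus> v\<^sub>j + c + d] / [w \<plusminus> v\<^sub>j + c]\<close> of \<open>H\<close>, and \<open>M\<close> is its numerator \<open>\<Prod>\<^sub>s [w + \<mu>\<^sub>s]\<close>. The expression is the
residue of \<open>H\<close> at the point \<open>\<sigma> v\<^sub>i - c\<close> of the first block, in the shape in which it occurs in the operators.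
\<close>

definition residue_term :: "bc_case \<Rightarrow> (complex \<Rightarrow> complex) \<Rightarrow> (nat \<Rightarrow> complex) \<Rightarrow> complex \<Rightarrow> complex \<Rightarrow> nat \<Rightarrow>
    (nat \<Rightarrow> complex) \<Rightarrow> complex \<Rightarrow> complex \<Rightarrow> nat \<Rightarrow> complex \<Rightarrow> nat \<Rightarrow> complex" where
  "residue_term C M v c d m v' c' d' n \<sigma> i = (let a = \<sigma> * v i - c in
     br C d * (M a / (br C (2 * (\<sigma> * v i)) * br C (2 * a + 2 * c' + d'))) *
     (\<Prod>j\<in>{1..m} - {i}. pm (br C) a (v j) (c + d) / pm (br C) a (v j) c) *
     ((\<Prod>l = 1..n. pm (br C) a (v' l) (c' + d') / pm (br C) a (v' l) c') - 1))"

text \<open>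
The denominators of \<open>residue_term\<close> are nonzero; in particular the node \<open>\<sigma> v\<^sub>i - c\<close> differs from all the others
modulo the period.
\<close>

definition simple_node :: "bc_case \<Rightarrow> (nat \<Rightarrow> complex) \<Rightarrow> complex \<Rightarrow> nat \<Rightarrow>
    (nat \<Rightarrow> complex) \<Rightarrow> complex \<Rightarrow> complex \<Rightarrow> nat \<Rightarrow> complex \<Rightarrow> nat \<Rightarrow> bool" where
  "simple_node C v c m v' c' d' n \<sigma> i \<longleftrightarrow> br C (2 * (\<sigma> * v i)) \<noteq> 0 \<and>
     br C (2 * (\<sigma> * v i - c) + 2 * c' + d') \<noteq> 0 \<and>
     (\<forall>j\<in>{1..m} - {i}. pm (br C) (\<sigma> * v i - c) (v j) c \<noteq> 0) \<and>
     (\<forall>l\<in>{1..n}. pm (br C) (\<sigma> * v i - c) (v' l) c' \<noteq> 0)"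

text \<open>
The left-hand side is the summand of the node sums: numerator polynomial over the product of the
brackets of the differences to the other nodes. At the node one of the factors \<open>[w \<plusminus> v\<^sub>i + c]\<close> vanishes, which turns the
first quotient into a product; in the second block the quotient is divided out.
\<close>

lemma residue_term_eq:
  assumes "simple_node C v c m v' c' d' n \<sigma> i" "i \<in> {1..m}" "\<sigma> \<in> {1, -1}"
  defines "a \<equiv> \<sigma> * v i - c"
  shows "M a * (telescoped_quot C m v c d a * telescoped_quot C n v' c' d' a) /
      (br C (2 * (\<sigma> * v i)) * (\<Prod>j\<in>{1..m} - {i}. pm (br C) a (v j) c) * (\<Prod>l = 1..n. pm (br C) a (v' l) c')) =
    residue_term C M v c d m v' c' d' n \<sigma> i"
proof -
  have "pm (br C) a (v i) c = 0" using assms(3) by (auto simp: pm_def a_def)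
  then have t1: "telescoped_quot C m v c d a = br C d * (\<Prod>j\<in>{1..m} - {i}. pm (br C) a (v j) (c + d))"
    by (rule telescoped_quot_at_node[OF assms(2)])
  let ?P = "\<Prod>l = 1..n. pm (br C) a (v' l) c'"
  let ?P' = "\<Prod>l = 1..n. pm (br C) a (v' l) (c' + d')"
  have nz: "br C (2 * a + 2 * c' + d') \<noteq> 0" "?P \<noteq> 0"
    using assms(1) by (auto simp: simple_node_def a_def)
  then have t2: "telescoped_quot C n v' c' d' a = (?P' - ?P) / br C (2 * a + 2 * c' + d')"
    using telescoped_quot_mult[of C a c' d' n v'] by (simp add: field_simps)
  have t3: "(?P' - ?P) = (?P' / ?P - 1) * ?P" using nz by (simp add: field_simps)
  have alg: "X * (e * A * (Y * q / s)) / (z * B * q) = e * (X / (z * s)) * (A / B) * Y"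
    if "q \<noteq> 0" for X e A Y q s z B :: complex using that by (simp add: mult_ac)
  show ?thesis
    unfolding residue_term_def Let_def a_def[symmetric] prod_dividef t1 t2 t3 by (rule alg[OF nz(2)])
qed

definition nodes :: "nat \<Rightarrow> nat \<Rightarrow> (complex \<times> nat + complex \<times> nat) set" where
  "nodes m n = ({1, -1} \<times> {1..m}) <+> ({1, -1} \<times> {1..n})"

definition node_pos :: "(nat \<Rightarrow> complex) \<Rightarrow> complex \<Rightarrow> (nat \<Rightarrow> complex) \<Rightarrow> complex \<Rightarrow>
    complex \<times> nat + complex \<times> nat \<Rightarrow> complex" where
  "node_pos v c v' c' = case_sum (\<lambda>(\<sigma>, i). \<sigma> * v i - c) (\<lambda>(\<sigma>, l). \<sigma> * v' l - c')"

lemma node_pos_simps [simp]: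
  "node_pos v c v' c' (Inl (\<sigma>, i)) = \<sigma> * v i - c" "node_pos v c v' c' (Inr (\<sigma>, l)) = \<sigma> * v' l - c'"
  by (auto simp: node_pos_def)

lemma finite_nodes [simp]: "finite (nodes m n)" by (simp add: nodes_def)

lemma card_nodes: "card (nodes m n) = 2 * (m + n)"
  by (simp add: nodes_def card_Plus card_cartesian_product)

lemma br_node_pair:
  "br C (a - (1 * u - c)) * br C (a - ((-1) * u - c)) = pm (br C) a u c"
  by (simp add: pm_def algebra_simps)

lemma prod_node_differences:
  assumes "\<sigma> \<in> {1, -1}"
  shows "i \<in> {1..m} \<Longrightarrow> (\<Prod>k\<in>nodes m n - {Inl (\<sigma>, i)}. br C (\<sigma> * v i - c - node_pos v c v' c' k)) =
      br C (2 * (\<sigma> * v i)) * (\<Prod>j\<in>{1..m} - {i}. pm (br C) (\<sigma> * v i - c) (v j) c) *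
      (\<Prod>l = 1..n. pm (br C) (\<sigma> * v i - c) (v' l) c')" (is "_ \<Longrightarrow> ?thesis1")
    and "l \<in> {1..n} \<Longrightarrow> (\<Prod>k\<in>nodes m n - {Inr (\<sigma>, l)}. br C (\<sigma> * v' l - c' - node_pos v c v' c' k)) =
      br C (2 * (\<sigma> * v' l)) * (\<Prod>j\<in>{1..n} - {l}. pm (br C) (\<sigma> * v' l - c') (v' j) c') *
      (\<Prod>j = 1..m. pm (br C) (\<sigma> * v' l - c') (v j) c)" (is "_ \<Longrightarrow> ?thesis2")
proof -
  assume i: "i \<in> {1..m}"
  have "nodes m n - {Inl (\<sigma>, i)} = ({1, -1} \<times> {1..m} - {(\<sigma>, i)}) <+> ({1, -1} \<times> {1..n})"
    by (auto simp: nodes_def)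
  then have "(\<Prod>k\<in>nodes m n - {Inl (\<sigma>, i)}. br C (\<sigma> * v i - c - node_pos v c v' c' k)) =
      (\<Prod>p\<in>{1, -1} \<times> {1..m} - {(\<sigma>, i)}. br C (\<sigma> * v i - c - node_pos v c v' c' (Inl p))) *
      (\<Prod>p\<in>{1, -1} \<times> {1..n}. br C (\<sigma> * v i - c - node_pos v c v' c' (Inr p)))"
    by (simp add: prod.Plus del: insert_iff)
  then show ?thesis1
    by (simp only: prod_signed_nodes_except[OF finite_atLeastAtMost i assms]
        prod_signed_nodes[OF finite_atLeastAtMost] node_pos_simps br_node_pair)
       (simp add: algebra_simps)
next
  assume l: "l \<in> {1..n}"
  have "nodes m n - {Inr (\<sigma>, l)} = ({1, -1} \<times> {1..m}) <+> ({1, -1} \<times> {1..n} - {(\<sigma>, l)})"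
    by (auto simp: nodes_def)
  then have "(\<Prod>k\<in>nodes m n - {Inr (\<sigma>, l)}. br C (\<sigma> * v' l - c' - node_pos v c v' c' k)) =
      (\<Prod>p\<in>{1, -1} \<times> {1..m}. br C (\<sigma> * v' l - c' - node_pos v c v' c' (Inl p))) *
      (\<Prod>p\<in>{1, -1} \<times> {1..n} - {(\<sigma>, l)}. br C (\<sigma> * v' l - c' - node_pos v c v' c' (Inr p)))"
    by (simp add: prod.Plus del: insert_iff)
  then show ?thesis2
    by (simp only: prod_signed_nodes_except[OF finite_atLeastAtMost l assms]
        prod_signed_nodes[OF finite_atLeastAtMost] node_pos_simps br_node_pair)
       (simp add: algebra_simps)
qed

text \<open>
The second part extracts the separation of the nodes, which the node sums need, from the nonvanishing
denominators.
\<close>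

lemma residue_sum_eq_node_sum:
  assumes ok: "\<And>\<sigma> i. \<sigma> \<in> {1, -1} \<Longrightarrow> i \<in> {1..m} \<Longrightarrow> simple_node C v c m v' c' d' n \<sigma> i"
    and ok': "\<And>\<sigma> l. \<sigma> \<in> {1, -1} \<Longrightarrow> l \<in> {1..n} \<Longrightarrow> simple_node C v' c' n v c d m \<sigma> l"
  defines "z \<equiv> node_pos v c v' c'"
  shows "(\<Sum>(\<sigma>, i)\<in>{1, -1} \<times> {1..m}. residue_term C M v c d m v' c' d' n \<sigma> i) +
      (\<Sum>(\<sigma>, l)\<in>{1, -1} \<times> {1..n}. residue_term C M v' c' d' n v c d m \<sigma> l) =
    (\<Sum>k\<in>nodes m n. M (z k) * (telescoped_quot C m v c d (z k) * telescoped_quot C n v' c' d' (z k)) /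
      (\<Prod>l\<in>nodes m n - {k}. br C (z k - z l)))"
    and "\<And>k l. k \<in> nodes m n \<Longrightarrow> l \<in> nodes m n \<Longrightarrow> k \<noteq> l \<Longrightarrow> br C (z k - z l) \<noteq> 0"
proof -
  have 1: "residue_term C M v c d m v' c' d' n \<sigma> i =
      M (z (Inl (\<sigma>, i))) * (telescoped_quot C m v c d (z (Inl (\<sigma>, i))) * telescoped_quot C n v' c' d' (z (Inl (\<sigma>, i)))) /
      (\<Prod>l\<in>nodes m n - {Inl (\<sigma>, i)}. br C (z (Inl (\<sigma>, i)) - z l))"
    if "\<sigma> \<in> {1, -1}" "i \<in> {1..m}" for \<sigma> i
    unfolding z_def node_pos_simps prod_node_differences(1)[OF that]
    by (rule residue_term_eq[OF ok[OF that] that(2,1), symmetric])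
  have 2: "residue_term C M v' c' d' n v c d m \<sigma> i =
      M (z (Inr (\<sigma>, i))) * (telescoped_quot C m v c d (z (Inr (\<sigma>, i))) * telescoped_quot C n v' c' d' (z (Inr (\<sigma>, i)))) /
      (\<Prod>l\<in>nodes m n - {Inr (\<sigma>, i)}. br C (z (Inr (\<sigma>, i)) - z l))"
    if "\<sigma> \<in> {1, -1}" "i \<in> {1..n}" for \<sigma> i
    unfolding z_def node_pos_simps prod_node_differences(2)[OF that] mult.commute[of "telescoped_quot C m v c d _"]
    by (rule residue_term_eq[OF ok'[OF that] that(2,1), symmetric])
  show "(\<Sum>(\<sigma>, i)\<in>{1, -1} \<times> {1..m}. residue_term C M v c d m v' c' d' n \<sigma> i) +
      (\<Sum>(\<sigma>, l)\<in>{1, -1} \<times> {1..n}. residue_term C M v' c' d' n v c d m \<sigma> l) =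
    (\<Sum>k\<in>nodes m n. M (z k) * (telescoped_quot C m v c d (z k) * telescoped_quot C n v' c' d' (z k)) /
      (\<Prod>l\<in>nodes m n - {k}. br C (z k - z l)))"
    unfolding nodes_def[of m n]
    by (subst sum.Plus; (simp only: finite_cartesian_product finite_insert finite.emptyI finite_atLeastAtMost)?)
       (intro arg_cong2[where f = "(+)"] sum.cong refl;
         use 1 2 in \<open>clarsimp simp only: split_paired_all case_prod_conv mem_Sigma_iff nodes_def comp_apply\<close>)
  fix k l assume kl: "k \<in> nodes m n" "l \<in> nodes m n" "k \<noteq> l"
  have "(\<Prod>l\<in>nodes m n - {k}. br C (z k - z l)) \<noteq> 0"
  proof (cases k)
    case (Inl p)
    then obtain \<sigma> i where k: "k = Inl (\<sigma>, i)" "\<sigma> \<in> {1, -1}" "i \<in> {1..m}"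
      using kl(1) by (auto simp: nodes_def)
    show ?thesis unfolding k(1) z_def node_pos_simps prod_node_differences(1)[OF k(2,3)]
      using ok[OF k(2,3)] by (auto simp: simple_node_def)
  next
    case (Inr p)
    then obtain \<sigma> i where k: "k = Inr (\<sigma>, i)" "\<sigma> \<in> {1, -1}" "i \<in> {1..n}"
      using kl(1) by (auto simp: nodes_def)
    show ?thesis unfolding k(1) z_def node_pos_simps prod_node_differences(2)[OF k(2,3)]
      using ok'[OF k(2,3)] by (auto simp: simple_node_def)
  qed
  then show "br C (z k - z l) \<noteq> 0" using kl by (auto simp: prod_zero_iff)
qed

lemma sum_node_pos:
  "(\<Sum>k\<in>nodes m n. node_pos v c v' c' k) = - 2 * of_nat m * c - 2 * of_nat n * c'"
proof -
  have "(\<Sum>k\<in>nodes m n. node_pos v c v' c' k) =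
    (\<Sum>p\<in>{1, -1} \<times> {1..m}. node_pos v c v' c' (Inl p)) + (\<Sum>p\<in>{1, -1} \<times> {1..n}. node_pos v c v' c' (Inr p))"
    unfolding nodes_def by (subst sum.Plus) auto
  then show ?thesis
    by (simp only: sum_signed_nodes[OF finite_atLeastAtMost] node_pos_simps)
       (simp add: sum_subtractf sum_negf)
qed

section \<open>The source identity\<close>

definition source_prod :: "bc_case \<Rightarrow> (nat \<Rightarrow> complex) \<Rightarrow> complex \<Rightarrow> complex" where
  "source_prod C \<mu> w = (\<Prod>s = 1..2 * rho C. br C (w + \<mu> s))"

text \<open>
The residues of \<open>H\<close> at the nodes of both blocks. In the trigonometric case the numerator is a
trigonometric polynomial whose degree equals the number \<open>2(m + n)\<close> of nodes: the four factors
\<open>[w + \<mu>\<^sub>s]\<close> are distributed in pairs over the two quotients. Both extreme coefficients carry the factors \<open>[md]\<close> and \<open>[nd']\<close>, and their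
difference supplies the third bracket. In the rational case one factor \<open>w + \<mu>\<^sub>s\<close> goes to each quotient
and the total degree is at most \<open>2(m + n) - 2\<close>.
\<close>

lemma source_identity:
  assumes ok: "\<And>\<sigma> i. \<sigma> \<in> {1, -1} \<Longrightarrow> i \<in> {1..m} \<Longrightarrow> simple_node C v c m v' c' d' n \<sigma> i"
    and ok': "\<And>\<sigma> l. \<sigma> \<in> {1, -1} \<Longrightarrow> l \<in> {1..n} \<Longrightarrow> simple_node C v' c' n v c d m \<sigma> l"
  shows "(\<Sum>(\<sigma>, i)\<in>{1, -1} \<times> {1..m}. residue_term C (source_prod C \<mu>) v c d m v' c' d' n \<sigma> i) +
      (\<Sum>(\<sigma>, l)\<in>{1, -1} \<times> {1..n}. residue_term C (source_prod C \<mu>) v' c' d' n v c d m \<sigma> l) =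
    (case C of Trigonometric _ \<Rightarrow> br C (of_nat m * d) * br C (of_nat n * d') *
        br C ((\<Sum>s = 1..2 * rho C. \<mu> s) + of_nat m * d + of_nat n * d' - (2 * c + d) - (2 * c' + d'))
     | Rational \<Rightarrow> 0)"
proof (rule residue_sum_eq_node_sum(1)[THEN trans], fact ok, fact ok')
  define z where "z = node_pos v c v' c'"
  have nz: "br C (z k - z l) \<noteq> 0" if "k \<in> nodes m n" "l \<in> nodes m n" "k \<noteq> l" for k l
    unfolding z_def by (rule residue_sum_eq_node_sum(2)[OF ok ok' that])
  show "(\<Sum>k\<in>nodes m n. source_prod C \<mu> (node_pos v c v' c' k) *
      (telescoped_quot C m v c d (node_pos v c v' c' k) * telescoped_quot C n v' c' d' (node_pos v c v' c' k)) /
      (\<Prod>l\<in>nodes m n - {k}. br C (node_pos v c v' c' k - node_pos v c v' c' l))) =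
    (case C of Trigonometric _ \<Rightarrow> br C (of_nat m * d) * br C (of_nat n * d') *
        br C ((\<Sum>s = 1..2 * rho C. \<mu> s) + of_nat m * d + of_nat n * d' - (2 * c + d) - (2 * c' + d'))
     | Rational \<Rightarrow> 0)"
    unfolding z_def[symmetric]
  proof (cases C)
    case C: (Trigonometric p)
    define B1 where "B1 w = br C (w + \<mu> 1) * br C (w + \<mu> 2)" for w
    define B2 where "B2 w = br C (w + \<mu> 3) * br C (w + \<mu> 4)" for w
    have e4: "{1..4::nat} = {1,2,3,4}" by auto
    have r4: "2 * rho C = 4" by (simp add: C)
    have M: "source_prod C \<mu> w = B1 w * B2 w" for w
      by (simp only: source_prod_def B1_def B2_def r4 e4) (simp add: mult.assoc)
    have S: "(\<Sum>s = 1..2 * rho C. \<mu> s) = \<mu> 1 + \<mu> 2 + \<mu> 3 + \<mu> 4"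
      by (simp only: r4 e4) (simp add: add.assoc)
    let ?t1 = "qe p (\<mu> 1) * qe p (\<mu> 2)" and ?t2 = "qe p (\<mu> 3) * qe p (\<mu> 4)"
    have B: "trig_poly p 2 ?t1 (inverse ?t1) B1" "trig_poly p 2 ?t2 (inverse ?t2) B2"
      using trig_poly_mult[OF trig_poly_br[of p "\<mu> 1"] trig_poly_br[of p "\<mu> 2"]]
        trig_poly_mult[OF trig_poly_br[of p "\<mu> 3"] trig_poly_br[of p "\<mu> 4"]]
      unfolding B1_def B2_def C one_add_one by (simp_all add: mult.commute)
    \<comment> \<open>\<open>qe p s\<close> and \<open>qe p s'\<close> are the powers of \<open>qe\<close> in the extreme coefficients of the two quotients.\<close>
    define s s' where "s = of_nat m * (2 * c + d) - (2 * c + d)" and "s' = of_nat n * (2 * c' + d') - (2 * c' + d')"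
    define h where "h w = source_prod C \<mu> w * (telescoped_quot C m v c d w * telescoped_quot C n v' c' d' w)" for w
    have h: "trig_poly p (card (nodes m n)) 
        (?t1 * (br C (of_nat m * d) * qe p s) * (?t2 * (br C (of_nat n * d') * qe p s')))
        (inverse ?t1 * (br C (of_nat m * d) * inverse (qe p s)) *
          (inverse ?t2 * (br C (of_nat n * d') * inverse (qe p s')))) h"
    proof -
      have h_eq: "h = (\<lambda>w. (B1 w * telescoped_quot C m v c d w) * (B2 w * telescoped_quot C n v' c' d' w))"
        by (rule ext) (simp add: h_def M mult_ac)
      have "card (nodes m n) = 2 * m + 2 * n" by (simp add: card_nodes)
      then show ?thesis
        unfolding h_eq s_def s'_def C by (simp only:)
          (rule trig_poly_mult[OF trig_poly_telescoped_quot[OF B(1)] trig_poly_telescoped_quot[OF B(2)]])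
    qed
    define T where "T = qe p ((\<Sum>s = 1..2 * rho C. \<mu> s) + of_nat m * d + of_nat n * d' - (2 * c + d) - (2 * c' + d'))"
    have "(\<Sum>s = 1..2 * rho C. \<mu> s) + of_nat m * d + of_nat n * d' - (2 * c + d) - (2 * c' + d') =
        \<mu> 1 + \<mu> 2 + \<mu> 3 + \<mu> 4 + s + s' + (\<Sum>k\<in>nodes m n. z k)"
      unfolding S z_def sum_node_pos by (simp add: s_def s'_def algebra_simps)
    then have T: "T = ?t1 * ?t2 * qe p s * qe p s' * qe p (\<Sum>k\<in>nodes m n. z k)"
      by (simp add: T_def qe_add mult_ac)
    have "(\<Sum>k\<in>nodes m n. h (z k) / (\<Prod>l\<in>nodes m n - {k}. br C (z k - z l))) =
      br C (of_nat m * d) * br C (of_nat n * d') * (T - inverse T)"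
      unfolding C
      by (subst trig_node_sum[OF h[unfolded C] finite_nodes])
         (use nz in \<open>auto simp: card_nodes C T algebra_simps\<close>)
    then show "(\<Sum>k\<in>nodes m n. source_prod C \<mu> (z k) * (telescoped_quot C m v c d (z k) * telescoped_quot C n v' c' d' (z k)) /
      (\<Prod>l\<in>nodes m n - {k}. br C (z k - z l))) =
    (case C of Trigonometric _ \<Rightarrow> br C (of_nat m * d) * br C (of_nat n * d') *
        br C ((\<Sum>s = 1..2 * rho C. \<mu> s) + of_nat m * d + of_nat n * d' - (2 * c + d) - (2 * c' + d'))
     | Rational \<Rightarrow> 0)" unfolding h_def T_def C bc_case.case br_qe .
  next
    case C: Rational
    have e2: "{1..2::nat} = {1,2}" by auto
    have r2: "2 * rho C = 2" by (simp add: C)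
    have M: "source_prod C \<mu> w = poly [:\<mu> 1, 1:] w * poly [:\<mu> 2, 1:] w" for w
      by (simp only: source_prod_def r2 e2) (simp add: C br.simps add.commute)
    obtain P where P: "P = 0 \<or> degree P < 2 * m" "\<And>w. poly [:\<mu> 1, 1:] w * telescoped_quot C m v c d w = poly P w"
      using rational_telescoped_quot[of "[:\<mu> 1, 1:]" m v c d] unfolding C by auto
    obtain Q where Q: "Q = 0 \<or> degree Q < 2 * n" "\<And>w. poly [:\<mu> 2, 1:] w * telescoped_quot C n v' c' d' w = poly Q w"
      using rational_telescoped_quot[of "[:\<mu> 2, 1:]" n v' c' d'] unfolding C by auto
    have h: "source_prod C \<mu> w * (telescoped_quot C m v c d w * telescoped_quot C n v' c' d' w) = poly (P * Q) w" for w
      unfolding M poly_mult P(2)[symmetric] Q(2)[symmetric] by (simp only: mult_ac)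
    have deg: "degree (P * Q) + 1 < card (nodes m n) \<or> P * Q = 0"
      using P(1) Q(1) degree_mult_le[of P Q] unfolding card_nodes by auto
    have inj: "inj_on z (nodes m n)"
      by (rule inj_onI, rule ccontr) (use nz in \<open>force simp: C br.simps\<close>)
    show "(\<Sum>k\<in>nodes m n. source_prod C \<mu> (z k) * (telescoped_quot C m v c d (z k) * telescoped_quot C n v' c' d' (z k)) /
      (\<Prod>l\<in>nodes m n - {k}. br C (z k - z l))) =
    (case C of Trigonometric _ \<Rightarrow> br C (of_nat m * d) * br C (of_nat n * d') *
        br C ((\<Sum>s = 1..2 * rho C. \<mu> s) + of_nat m * d + of_nat n * d' - (2 * c + d) - (2 * c' + d'))
     | Rational \<Rightarrow> 0)"
      unfolding h using rational_node_sum[OF deg finite_nodes inj] by (simp add: C br.simps)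
  qed
qed

section \<open>Coefficients of the operators as residues\<close>

text \<open>
The constant by which the denominators of \<open>A_plus\<close> differ from \<open>[2u] [2u + \<delta>]\<close>.
\<close>

definition duplication_const :: "bc_case \<Rightarrow> complex" where
  "duplication_const C = (case C of Trigonometric _ \<Rightarrow> -1 | Rational \<Rightarrow> 1 / 4)"

definition nondegenerate :: "bc_case \<Rightarrow> bool" where
  "nondegenerate C \<longleftrightarrow> (case C of Trigonometric p \<Rightarrow> p \<noteq> 0 | Rational \<Rightarrow> True)"

lemma duplication_const_nonzero [simp]: "duplication_const C \<noteq> 0"
  by (cases C) (auto simp: duplication_const_def)

text \<open>
This is the duplication formula of the sine, because \<open>[u - p/2]\<close> is \<open>-2i\<close> times a cosine.
\<close>

lemma br_half_period:
  assumes "p \<noteq> 0"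
  shows "br (Trigonometric p) (u - p / 2) * br (Trigonometric p) u = - \<i> * br (Trigonometric p) (2 * u)"
proof -
  define t where "t = of_real pi * u / p"
  have e: "of_real pi * (u - p / 2) / p = t - of_real pi / 2" "of_real pi * (2 * u) / p = 2 * t"
    using assms by (auto simp: t_def field_simps)
  have "sin (t - of_real pi / 2) = - cos t"
    by (simp add: sin_diff sin_of_real_pi_half cos_of_real_pi_half)
  then show ?thesis
    unfolding br.simps e t_def[symmetric] by (simp add: sin_double mult.left_commute[of "cos t" "\<i>"])
qed

lemma br_period:
  assumes "p \<noteq> 0"
  shows "br (Trigonometric p) (u + p) = - br (Trigonometric p) u"
proof -
  have "of_real pi * (u + p) / p = of_real pi * u / p + of_real pi"
    using assms by (simp add: field_simps)
  then show ?thesis by (simp add: br.simps sin_add)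
qed

text \<open>
The product over the half periods \<open>\<omega>\<^sub>s/2\<close> is a duplicated bracket, at \<open>u\<close> and at \<open>u + \<delta>/2\<close>. This is what
matches the operators with the denominators \<open>[2w + \<kappa>] [2w + \<delta>]\<close> of \<open>H\<close>, evaluated at the nodes.
\<close>

lemma duplication:
  assumes "nondegenerate C"
  shows "(\<Prod>s = 1..rho C. br C (u - omega C s / 2) * br C (u + (\<delta> - omega C s) / 2)) =
    duplication_const C * (br C (2 * u) * br C (2 * u + \<delta>))"
proof (cases C)
  case C: (Trigonometric p)
  have p: "p \<noteq> 0" using assms by (simp add: nondegenerate_def C)
  have e: "{1..rho C} = {1, 2}" by (auto simp: C)
  have ii: "(- \<i> * X) * (- \<i> * Y) = - (X * Y)" for X Y :: complex
  proof -
    have "(- \<i> * X) * (- \<i> * Y) = (\<i> * \<i>) * (X * Y)"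
      by (simp only: mult_minus_left mult_minus_right minus_minus mult_ac)
    then show ?thesis by simp
  qed
  have "(\<Prod>s = 1..rho C. br C (u - omega C s / 2) * br C (u + (\<delta> - omega C s) / 2)) =
    (br C (u - p / 2) * br C u) * (br C ((u + \<delta> / 2) - p / 2) * br C (u + \<delta> / 2))"
    by (simp only: e) (simp add: C diff_divide_distrib add_diff_eq)
  also have "\<dots> = - (br C (2 * u) * br C (2 * (u + \<delta> / 2)))"
    unfolding C br_half_period[OF p] by (rule ii)
  finally show ?thesis by (simp add: C duplication_const_def distrib_left)
next
  case Rational
  then show ?thesis by (simp add: duplication_const_def br.simps field_simps)
qed

lemma A_plus_dup:
  assumes "nondegenerate C"
  shows "A_plus C \<mu> \<delta> \<kappa> N i x = source_prod C \<mu> (x i) / (duplication_const C * (br C (2 * x i) * br C (2 * x i + \<delta>))) *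
     (\<Prod>j\<in>{1..N} - {i}. pm (br C) (x i) (x j) \<kappa> / pm (br C) (x i) (x j) 0)"
  unfolding A_plus_def duplication[OF assms] source_prod_def ..

lemma A_plus_defined_dup:
  assumes "nondegenerate C"
  shows "A_plus_defined C \<delta> N i x \<longleftrightarrow> br C (2 * x i) \<noteq> 0 \<and> br C (2 * x i + \<delta>) \<noteq> 0 \<and>
    (\<forall>j\<in>{1..N} - {i}. pm (br C) (x i) (x j) 0 \<noteq> 0)"
proof -
  have "(\<forall>s\<in>{1..rho C}. br C (x i - omega C s / 2) \<noteq> 0 \<and> br C (x i + (\<delta> - omega C s) / 2) \<noteq> 0) \<longleftrightarrow>
     (\<Prod>s = 1..rho C. br C (x i - omega C s / 2) * br C (x i + (\<delta> - omega C s) / 2)) \<noteq> 0"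
    by (auto simp: prod_zero_iff)
  then show ?thesis unfolding A_plus_defined_def duplication[OF assms] by auto
qed

lemma pm_minus_right [simp]: "pm f u (- v) c = pm f u v c"
  by (simp add: pm_def mult.commute)

lemma pm_sign_right: "\<sigma> \<in> {1, -1} \<Longrightarrow> pm f u (\<sigma> * v) c = pm f u v c"
  by auto

lemma pm_reflect: "pm (br C) (- u) v (- c) = pm (br C) u v c"
proof -
  have "- u + v + - c = - (u - v + c)" "- u - v + - c = - (u + v + c)" by auto
  then show ?thesis unfolding pm_def by (simp only: br_minus) simp
qed

lemma pm_shift: "pm f (u - e) v c = pm f u v (c - e)"
  by (simp add: pm_def algebra_simps)

text \<open>
With \<open>a = \<sigma> x\<^sub>i\<close> the denominator \<open>[2a + 2\<alpha> + \<beta>]\<close> is \<open>[2a + \<delta>]\<close>. Because \<open>A_minus\<close> is \<open>A_plus\<close> at \<open>-x\<close>, both are treated at once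
through the sign \<open>\<sigma>\<close>.
\<close>

lemma residue_term_A_plus:
  assumes "nondegenerate C" "2 * \<alpha> + \<beta> = \<delta>" "\<sigma> \<in> {1, -1}"
  shows "residue_term C (source_prod C \<mu>) x 0 \<kappa> m y \<alpha> \<beta> n \<sigma> i =
    duplication_const C * (br C \<kappa> * (A_plus C \<mu> \<delta> \<kappa> m i (\<lambda>j. \<sigma> * x j) *
     ((\<Prod>l = 1..n. pm (br C) (\<sigma> * x i) (y l) (\<alpha> + \<beta>) / pm (br C) (\<sigma> * x i) (y l) \<alpha>) - 1)))"
proof -
  have d: "2 * (\<sigma> * x i - 0) + 2 * \<alpha> + \<beta> = 2 * (\<sigma> * x i) + \<delta>" using assms(2) by (simp add: add.assoc)
  show ?thesis
    unfolding residue_term_def Let_def A_plus_dup[OF assms(1)] d pm_sign_right[OF assms(3)] by simp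
qed

lemma source_prod_reflect:
  assumes "\<And>r. r \<in> {1..2 * rho C} \<Longrightarrow> \<nu> r = \<alpha> - \<mu> r"
  shows "source_prod C \<mu> (- u - \<alpha>) = source_prod C \<nu> u"
proof -
  have "source_prod C \<mu> (- u - \<alpha>) = (\<Prod>s = 1..2 * rho C. - br C (u + \<nu> s))"
    unfolding source_prod_def br_minus[symmetric] by (rule prod.cong) (simp_all add: assms algebra_simps)
  then show ?thesis by (simp add: source_prod_def prod_uminus)
qed

text \<open>
For the kernels \<open>\<Phi>\<close> the node \<open>-\<sigma> y\<^sub>l - (\<delta> + \<kappa>)/2\<close> belongs to the shift of \<open>y\<^sub>l\<close> by \<open>\<sigma>\<delta>\<close>. The substitution
\<open>w = -u - (\<delta> + \<kappa>)/2\<close> exchanges \<open>[2w + \<kappa>]\<close> with \<open>-[2u + \<delta>]\<close> and turns \<open>[w + \<mu>\<^sub>s]\<close> into \<open>-[u + \<nu>\<^sub>s]\<close>, where the even number of factors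
makes the signs disappear. This is the origin of the dual parameters \<open>\<nu>\<close>; the overall
sign comes from \<open>\<beta> = -\<kappa>\<close>.
\<close>

lemma residue_term_A_plus_reflected:
  assumes "nondegenerate C" "\<sigma> \<in> {1, -1}"
    and \<nu>: "\<And>r. r \<in> {1..2 * rho C} \<Longrightarrow> \<nu> r = (\<delta> + \<kappa>) / 2 - \<mu> r"
  shows "residue_term C (source_prod C \<mu>) y ((\<delta> + \<kappa>) / 2) (- \<kappa>) n x 0 \<kappa> m (- \<sigma>) l =
    - (duplication_const C * (br C \<kappa> * (A_plus C \<nu> \<delta> \<kappa> n l (\<lambda>j. \<sigma> * y j) *
     ((\<Prod>j = 1..m. pm (br C) (\<sigma> * y l) (x j) ((\<delta> - \<kappa>) / 2) / pm (br C) (\<sigma> * y l) (x j) ((\<delta> + \<kappa>) / 2)) - 1))))"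
proof -
  define u \<alpha> where "u = \<sigma> * y l" and "\<alpha> = (\<delta> + \<kappa>) / 2"
  have a: "- \<sigma> * y l = - u" by (simp add: u_def)
  have half: "\<alpha> - \<kappa> = (\<delta> - \<kappa>) / 2" by (simp add: \<alpha>_def field_simps)
  have d: "br C (2 * - u) * br C (2 * (- u - \<alpha>) + 2 * 0 + \<kappa>) = br C (2 * u) * br C (2 * u + \<delta>)"
  proof -
    have "2 * (- u - \<alpha>) + 2 * 0 + \<kappa> = - (2 * u + \<delta>)" by (simp add: \<alpha>_def field_simps)
    then show ?thesis by (simp only: mult_minus_right br_minus) simp
  qed
  have q: "pm (br C) (- u - \<alpha>) v (\<alpha> + - \<kappa>) = pm (br C) u v \<kappa>" "pm (br C) (- u - \<alpha>) v \<alpha> = pm (br C) u v 0"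
    "pm (br C) (- u - \<alpha>) v (0 + \<kappa>) = pm (br C) u v ((\<delta> - \<kappa>) / 2)"
    "pm (br C) (- u - \<alpha>) v 0 = pm (br C) u v \<alpha>" for v
    using pm_reflect[of C u v \<kappa>] pm_reflect[of C u v 0] pm_reflect[of C u v "\<alpha> - \<kappa>"] pm_reflect[of C u v \<alpha>]
    unfolding half[symmetric] by (simp_all add: pm_shift)
  have M: "source_prod C \<mu> (- u - \<alpha>) = source_prod C \<nu> u"
    using \<nu> unfolding \<alpha>_def[symmetric] by (rule source_prod_reflect)
  show ?thesis
    unfolding residue_term_def Let_def A_plus_dup[OF assms(1)] a pm_sign_right[OF assms(2)]
      \<alpha>_def[symmetric] u_def[symmetric] d q M by simp
qed

lemma D_op_signed:
  "D_op C \<mu> \<delta> \<kappa> N f x = (\<Sum>(\<sigma>, i)\<in>{1, -1} \<times> {1..N}.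
     A_plus C \<mu> \<delta> \<kappa> N i (\<lambda>j. \<sigma> * x j) * (f (shift i (\<sigma> * \<delta>) x) - f x))"
  unfolding D_op_def A_minus_def by (subst sum_signed_nodes) simp_all

lemma D_op_ratio:
  assumes "\<forall>\<sigma>\<in>{1, -1}. \<forall>i\<in>{1..N}. f (shift i (\<sigma> * \<delta>) x) = f x * R \<sigma> i"
  shows "D_op C \<mu> \<delta> \<kappa> N f x = f x * (\<Sum>(\<sigma>, i)\<in>{1, -1} \<times> {1..N}.
     A_plus C \<mu> \<delta> \<kappa> N i (\<lambda>j. \<sigma> * x j) * (R \<sigma> i - 1))"
  unfolding D_op_signed sum_distrib_left
  by (rule sum.cong[OF refl]) (clarsimp simp only: split_paired_all case_prod_conv mem_Sigma_iff assms[rule_format], simp add: algebra_simps)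

text \<open>
No pole of the \<open>x\<close> block of \<open>H\<close> meets one of the \<open>y\<close> block.
\<close>

definition separated :: "bc_case \<Rightarrow> complex \<Rightarrow> nat \<Rightarrow> nat \<Rightarrow> (nat \<Rightarrow> complex) \<Rightarrow> (nat \<Rightarrow> complex) \<Rightarrow> bool" where
  "separated C c m n x y \<longleftrightarrow> (\<forall>j\<in>{1..m}. \<forall>l\<in>{1..n}. \<forall>\<sigma>\<in>{1, -1}. \<forall>\<tau>\<in>{1, -1}.
     br C (\<sigma> * x j + \<tau> * y l + c) \<noteq> 0)"

definition A_defined :: "bc_case \<Rightarrow> complex \<Rightarrow> nat \<Rightarrow> (nat \<Rightarrow> complex) \<Rightarrow> bool" where
  "A_defined C \<delta> N x \<longleftrightarrow> (\<forall>\<sigma>\<in>{1, -1}. \<forall>i\<in>{1..N}. A_plus_defined C \<delta> N i (\<lambda>j. \<sigma> * x j))"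

lemma separated_swap: "separated C c m n x y \<Longrightarrow> separated C c n m y x"
  unfolding separated_def by (metis add.commute)

lemma separated_pm:
  assumes "separated C c m n x y" "j \<in> {1..m}" "l \<in> {1..n}" "\<sigma> \<in> {1, -1}"
  shows "pm (br C) (\<sigma> * x j) (y l) c \<noteq> 0"
proof -
  have "br C (\<sigma> * x j + 1 * y l + c) \<noteq> 0" "br C (\<sigma> * x j + (-1) * y l + c) \<noteq> 0"
    using assms unfolding separated_def by blast+
  then show ?thesis by (simp add: pm_def)
qed

lemma simple_node_A_defined:
  assumes "nondegenerate C" "2 * \<alpha> + \<beta> = \<delta>" "A_defined C \<delta> m x" "separated C \<alpha> m n x y"
    and "\<sigma> \<in> {1, -1}" "i \<in> {1..m}"
  shows "simple_node C x 0 m y \<alpha> \<beta> n \<sigma> i"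
proof -
  have d: "2 * (\<sigma> * x i - 0) + 2 * \<alpha> + \<beta> = 2 * (\<sigma> * x i) + \<delta>" using assms(2) by (simp add: add.assoc)
  have "A_plus_defined C \<delta> m i (\<lambda>j. \<sigma> * x j)" using assms unfolding A_defined_def by blast
  then show ?thesis
    unfolding A_plus_defined_dup[OF assms(1)] simple_node_def d pm_sign_right[OF assms(5)]
    using separated_pm[OF assms(4,6) _ assms(5)] by simp
qed

lemma simple_node_A_defined_reflected:
  assumes "nondegenerate C" "A_defined C \<delta> n y" "separated C ((\<delta> + \<kappa>) / 2) m n x y"
    and "\<sigma> \<in> {1, -1}" "l \<in> {1..n}"
  shows "simple_node C y ((\<delta> + \<kappa>) / 2) n x 0 \<kappa> m \<sigma> l"
proof -
  define u \<alpha> where "u = - \<sigma> * y l" and "\<alpha> = (\<delta> + \<kappa>) / 2"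
  have s: "- \<sigma> \<in> {1, -1}" using assms(4) by auto
  have a: "\<sigma> * y l = - u" by (simp add: u_def)
  have q: "pm (br C) (- u - \<alpha>) v \<alpha> = pm (br C) u v 0" "pm (br C) (- u - \<alpha>) v 0 = pm (br C) u v \<alpha>" for v
    using pm_reflect[of C u v 0] pm_reflect[of C u v \<alpha>] by (simp_all add: pm_shift)
  have d: "2 * (- u - \<alpha>) + 2 * 0 + \<kappa> = - (2 * u + \<delta>)" by (simp add: \<alpha>_def field_simps)
  have "A_plus_defined C \<delta> n l (\<lambda>j. - \<sigma> * y j)" using assms(2,5) s unfolding A_defined_def by blast
  moreover have "pm (br C) u (x j) \<alpha> \<noteq> 0" if "j \<in> {1..m}" for j
    unfolding u_def using separated_pm[OF separated_swap[OF assms(3)] assms(5) that s] by (simp add: \<alpha>_def)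
  ultimately show ?thesis
    unfolding A_plus_defined_dup[OF assms(1)] simple_node_def a \<alpha>_def[symmetric] q d pm_sign_right[OF s]
    using br_minus[of C "\<delta> - 2 * (\<sigma> * y l)"] by (simp add: u_def)
qed

text \<open>
The scalar on the right-hand sides, with \<open>a = m\<kappa>\<close> and \<open>b = n\<beta>\<close>.
\<close>

definition eigenvalue :: "bc_case \<Rightarrow> complex \<Rightarrow> complex \<Rightarrow> complex \<Rightarrow> complex" where
  "eigenvalue C a b c = (case C of Trigonometric _ \<Rightarrow> br C a * br C b * br C (a + b + c) | Rational \<Rightarrow> 0)"

text \<open>
The summand \<open>\<Sum>\<^sub>s \<omega>\<^sub>s = \<omega>\<^sub>1\<close> in \<open>c_const\<close> changes the sign of the third bracket, which compensates the constant
\<open>-1\<close> of the duplication formula.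
\<close>

lemma source_identity_eigenvalue:
  assumes C: "nondegenerate C"
    and ok: "\<And>\<sigma> i. \<sigma> \<in> {1, -1} \<Longrightarrow> i \<in> {1..m} \<Longrightarrow> simple_node C x 0 m y \<alpha> \<beta> n \<sigma> i"
    and ok': "\<And>\<sigma> l. \<sigma> \<in> {1, -1} \<Longrightarrow> l \<in> {1..n} \<Longrightarrow> simple_node C y \<alpha> n x 0 \<kappa> m \<sigma> l"
    and \<delta>: "2 * \<alpha> + \<beta> = \<delta>"
  shows "(\<Sum>(\<sigma>, i)\<in>{1, -1} \<times> {1..m}. residue_term C (source_prod C \<mu>) x 0 \<kappa> m y \<alpha> \<beta> n \<sigma> i) +
      (\<Sum>(\<sigma>, l)\<in>{1, -1} \<times> {1..n}. residue_term C (source_prod C \<mu>) y \<alpha> \<beta> n x 0 \<kappa> m \<sigma> l) =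
    duplication_const C * eigenvalue C (of_nat m * \<kappa>) (of_nat n * \<beta>) (c_const C \<mu> \<delta> \<kappa>)"
proof -
  note id = source_identity[OF ok ok', of \<mu>]
  show ?thesis
  proof (cases C)
    case t: (Trigonometric p)
    have p: "p \<noteq> 0" using C by (simp add: nondegenerate_def t)
    have e: "{1..rho C} = {1, 2}" by (auto simp: t)
    have om: "(\<Sum>s = 1..rho C. omega C s) = p" by (simp only: e) (simp add: t)
    have "of_nat m * \<kappa> + of_nat n * \<beta> + c_const C \<mu> \<delta> \<kappa> =
      ((\<Sum>s = 1..2 * rho C. \<mu> s) + of_nat m * \<kappa> + of_nat n * \<beta> - (2 * 0 + \<kappa>) - (2 * \<alpha> + \<beta>)) + p"
      unfolding c_const_def om \<delta> by (simp add: t)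
    then have "br C (of_nat m * \<kappa> + of_nat n * \<beta> + c_const C \<mu> \<delta> \<kappa>) =
      - br C ((\<Sum>s = 1..2 * rho C. \<mu> s) + of_nat m * \<kappa> + of_nat n * \<beta> - (2 * 0 + \<kappa>) - (2 * \<alpha> + \<beta>))"
      unfolding t by (simp only: br_period[OF p])
    then show ?thesis using id unfolding eigenvalue_def by (simp add: t duplication_const_def)
  next
    case Rational
    then show ?thesis using id by (simp add: eigenvalue_def)
  qed
qed

section \<open>Kernel identities at separated points\<close>

text \<open>
Only the multipliers of \<open>\<Phi>\<close> under the shifts matter, hence both kernels built from \<open>G\<close> are covered.
\<close>

lemma kernel_identity_first:
  assumes C: "nondegenerate C"
    and A: "A_defined C \<delta> m x" "A_defined C \<delta> n y" and sep: "separated C ((\<delta> + \<kappa>) / 2) m n x y"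
    and \<nu>: "\<And>r. r \<in> {1..2 * rho C} \<Longrightarrow> \<nu> r = (\<delta> + \<kappa>) / 2 - \<mu> r"
    and x: "\<forall>\<sigma>\<in>{1, -1}. \<forall>i\<in>{1..m}. \<Phi> (shift i (\<sigma> * \<delta>) x) y = \<Phi> x y *
      (\<Prod>l = 1..n. pm (br C) (\<sigma> * x i) (y l) ((\<delta> - \<kappa>) / 2) / pm (br C) (\<sigma> * x i) (y l) ((\<delta> + \<kappa>) / 2))"
    and y: "\<forall>\<sigma>\<in>{1, -1}. \<forall>i\<in>{1..n}. \<Phi> x (shift i (\<sigma> * \<delta>) y) = \<Phi> x y *
      (\<Prod>j = 1..m. pm (br C) (\<sigma> * y i) (x j) ((\<delta> - \<kappa>) / 2) / pm (br C) (\<sigma> * y i) (x j) ((\<delta> + \<kappa>) / 2))"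
  shows "br C \<kappa> * D_op C \<mu> \<delta> \<kappa> m (\<lambda>x'. \<Phi> x' y) x - br C \<kappa> * D_op C \<nu> \<delta> \<kappa> n (\<lambda>y'. \<Phi> x y') y =
    eigenvalue C (of_nat m * \<kappa>) (of_nat n * - \<kappa>) (c_const C \<mu> \<delta> \<kappa>) * \<Phi> x y"
proof -
  have 2: "2 * ((\<delta> + \<kappa>) / 2) + - \<kappa> = \<delta>" "(\<delta> + \<kappa>) / 2 + - \<kappa> = (\<delta> - \<kappa>) / 2" by (auto simp: field_simps)
  let ?r = "\<lambda>\<sigma> i. residue_term C (source_prod C \<mu>) x 0 \<kappa> m y ((\<delta> + \<kappa>) / 2) (- \<kappa>) n \<sigma> i"
  let ?s = "\<lambda>\<sigma> i. residue_term C (source_prod C \<mu>) y ((\<delta> + \<kappa>) / 2) (- \<kappa>) n x 0 \<kappa> m \<sigma> i"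
  have src: "(\<Sum>(\<sigma>, i)\<in>{1, -1} \<times> {1..m}. ?r \<sigma> i) + (\<Sum>(\<sigma>, l)\<in>{1, -1} \<times> {1..n}. ?s \<sigma> l) =
    duplication_const C * eigenvalue C (of_nat m * \<kappa>) (of_nat n * - \<kappa>) (c_const C \<mu> \<delta> \<kappa>)"
    using simple_node_A_defined[OF C 2(1) A(1) sep] simple_node_A_defined_reflected[OF C A(2) sep]
    by (intro source_identity_eigenvalue[OF C _ _ 2(1)]) auto
  have Dx: "duplication_const C * (br C \<kappa> * D_op C \<mu> \<delta> \<kappa> m (\<lambda>x'. \<Phi> x' y) x) =
      \<Phi> x y * (\<Sum>(\<sigma>, i)\<in>{1, -1} \<times> {1..m}. ?r \<sigma> i)"
    unfolding D_op_ratio[where f="\<lambda>x'. \<Phi> x' y", OF x] sum_distrib_left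
    by (rule sum.cong[OF refl])
       (clarsimp simp only: split_paired_all case_prod_conv mem_Sigma_iff residue_term_A_plus[OF C 2(1)] 2(2),
        simp add: mult_ac)
  \<comment> \<open>The node with sign \<open>-\<sigma>\<close> belongs to the shift by \<open>\<sigma>\<delta>\<close>, so the signs are exchanged in the sum.\<close>
  have flip: "(\<Sum>(\<sigma>, l)\<in>{1, -1} \<times> {1..n}. ?s \<sigma> l) = (\<Sum>(\<sigma>, l)\<in>{1, -1} \<times> {1..n}. ?s (- \<sigma>) l)"
    by (simp add: sum_signed_nodes add.commute)
  have Dy: "- (duplication_const C * (br C \<kappa> * D_op C \<nu> \<delta> \<kappa> n (\<lambda>y'. \<Phi> x y') y)) =
      \<Phi> x y * (\<Sum>(\<sigma>, l)\<in>{1, -1} \<times> {1..n}. ?s \<sigma> l)"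
    unfolding flip D_op_ratio[where f="\<lambda>y'. \<Phi> x y'", OF y] sum_distrib_left sum_negf[symmetric]
    by (rule sum.cong[OF refl])
       (clarsimp simp only: split_paired_all case_prod_conv mem_Sigma_iff residue_term_A_plus_reflected[OF C _ \<nu>],
        simp add: mult_ac)
  have "duplication_const C * (br C \<kappa> * D_op C \<mu> \<delta> \<kappa> m (\<lambda>x'. \<Phi> x' y) x - br C \<kappa> * D_op C \<nu> \<delta> \<kappa> n (\<lambda>y'. \<Phi> x y') y) =
    \<Phi> x y * ((\<Sum>(\<sigma>, i)\<in>{1, -1} \<times> {1..m}. ?r \<sigma> i) + (\<Sum>(\<sigma>, l)\<in>{1, -1} \<times> {1..n}. ?s \<sigma> l))"
    unfolding distrib_left Dx[symmetric] Dy[symmetric] by (simp add: algebra_simps)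
  then show ?thesis unfolding src by simp
qed

lemma kernel_identity_second:
  assumes C: "nondegenerate C"
    and A: "A_defined C \<delta> m x" "A_defined C \<kappa> n y" and sep: "separated C 0 m n x y"
    and x: "\<forall>\<sigma>\<in>{1, -1}. \<forall>i\<in>{1..m}. \<Phi> (shift i (\<sigma> * \<delta>) x) y = \<Phi> x y *
      (\<Prod>l = 1..n. pm (br C) (\<sigma> * x i) (y l) \<delta> / pm (br C) (\<sigma> * x i) (y l) 0)"
    and y: "\<forall>\<sigma>\<in>{1, -1}. \<forall>i\<in>{1..n}. \<Phi> x (shift i (\<sigma> * \<kappa>) y) = \<Phi> x y *
      (\<Prod>j = 1..m. pm (br C) (\<sigma> * y i) (x j) \<kappa> / pm (br C) (\<sigma> * y i) (x j) 0)"
  shows "br C \<kappa> * D_op C \<mu> \<delta> \<kappa> m (\<lambda>x'. \<Phi> x' y) x + br C \<delta> * D_op C \<mu> \<kappa> \<delta> n (\<lambda>y'. \<Phi> x y') y =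
    eigenvalue C (of_nat m * \<kappa>) (of_nat n * \<delta>) (c_const C \<mu> \<delta> \<kappa>) * \<Phi> x y"
proof -
  have 2: "2 * 0 + e = e" for e :: complex by simp
  let ?r = "\<lambda>\<sigma> i. residue_term C (source_prod C \<mu>) x 0 \<kappa> m y 0 \<delta> n \<sigma> i"
  let ?s = "\<lambda>\<sigma> i. residue_term C (source_prod C \<mu>) y 0 \<delta> n x 0 \<kappa> m \<sigma> i"
  have src: "(\<Sum>(\<sigma>, i)\<in>{1, -1} \<times> {1..m}. ?r \<sigma> i) + (\<Sum>(\<sigma>, l)\<in>{1, -1} \<times> {1..n}. ?s \<sigma> l) =
    duplication_const C * eigenvalue C (of_nat m * \<kappa>) (of_nat n * \<delta>) (c_const C \<mu> \<delta> \<kappa>)"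
    using simple_node_A_defined[OF C 2 A(1) sep] simple_node_A_defined[OF C 2 A(2) separated_swap[OF sep]]
    by (intro source_identity_eigenvalue[OF C _ _ 2]) auto
  have Dx: "duplication_const C * (br C \<kappa> * D_op C \<mu> \<delta> \<kappa> m (\<lambda>x'. \<Phi> x' y) x) =
      \<Phi> x y * (\<Sum>(\<sigma>, i)\<in>{1, -1} \<times> {1..m}. ?r \<sigma> i)"
    unfolding D_op_ratio[where f="\<lambda>x'. \<Phi> x' y", OF x] sum_distrib_left
    by (rule sum.cong[OF refl])
       (clarsimp simp only: split_paired_all case_prod_conv mem_Sigma_iff residue_term_A_plus[OF C 2] add_0_left,
        simp add: mult_ac)
  have Dy: "duplication_const C * (br C \<delta> * D_op C \<mu> \<kappa> \<delta> n (\<lambda>y'. \<Phi> x y') y) =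
      \<Phi> x y * (\<Sum>(\<sigma>, l)\<in>{1, -1} \<times> {1..n}. ?s \<sigma> l)"
    unfolding D_op_ratio[where f="\<lambda>y'. \<Phi> x y'", OF y] sum_distrib_left
    by (rule sum.cong[OF refl])
       (clarsimp simp only: split_paired_all case_prod_conv mem_Sigma_iff residue_term_A_plus[OF C 2] add_0_left,
        simp add: mult_ac)
  have "duplication_const C * (br C \<kappa> * D_op C \<mu> \<delta> \<kappa> m (\<lambda>x'. \<Phi> x' y) x + br C \<delta> * D_op C \<mu> \<kappa> \<delta> n (\<lambda>y'. \<Phi> x y') y) =
    \<Phi> x y * ((\<Sum>(\<sigma>, i)\<in>{1, -1} \<times> {1..m}. ?r \<sigma> i) + (\<Sum>(\<sigma>, l)\<in>{1, -1} \<times> {1..n}. ?s \<sigma> l))"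
    unfolding distrib_left Dx[symmetric] Dy[symmetric] by (simp add: algebra_simps)
  then show ?thesis unfolding src by simp
qed

section \<open>Perturbation of the points\<close>

lemma tendsto_br [tendsto_intros]: "(f \<longlongrightarrow> l) F \<Longrightarrow> ((\<lambda>t. br C (f t)) \<longlongrightarrow> br C l) F"
  by (rule isCont_tendsto_compose) (cases C; auto simp: br.simps[abs_def] divide_inverse)

lemma tendsto_pm_br [tendsto_intros]:
  "(f \<longlongrightarrow> l) F \<Longrightarrow> (g \<longlongrightarrow> k) F \<Longrightarrow> ((\<lambda>t. pm (br C) (f t) (g t) c) \<longlongrightarrow> pm (br C) l k c) F"
  unfolding pm_def by (intro tendsto_intros)

text \<open>
The zeros of the bracket are simple: where it vanishes, its derivative does not.
\<close>

lemma br_eventually_nonzero: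
  assumes "nondegenerate C" "\<sigma> \<noteq> 0"
  shows "\<forall>\<^sub>F t in at 0. br C (u + \<sigma> * t) \<noteq> 0"
proof (cases "br C u = 0")
  case False
  have "((\<lambda>t. br C (u + \<sigma> * t)) \<longlongrightarrow> br C (u + \<sigma> * 0)) (at 0)" by (intro tendsto_intros)
  then show ?thesis using False by (intro tendsto_imp_eventually_ne) auto
next
  case True
  obtain D where D: "((\<lambda>t. br C (u + \<sigma> * t)) has_field_derivative D) (at 0)" "D \<noteq> 0"
  proof (cases C)
    case C: (Trigonometric p)
    have p: "p \<noteq> 0" using assms by (simp add: nondegenerate_def C)
    have "cos (of_real pi * u / p) \<noteq> 0"
      using True sin_cos_squared_add[of "of_real pi * u / p"] by (auto simp: C br.simps)
    then have "2 * \<i> * (cos (of_real pi * (u + \<sigma> * 0) / p) * (of_real pi * \<sigma> / p)) \<noteq> 0"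
      using p assms(2) by simp
    moreover have "((\<lambda>t. br C (u + \<sigma> * t)) has_field_derivative
        2 * \<i> * (cos (of_real pi * (u + \<sigma> * 0) / p) * (of_real pi * \<sigma> / p))) (at 0)"
      unfolding C br.simps by (auto intro!: derivative_eq_intros simp: p)
    ultimately show ?thesis by (rule that[rotated])
  next
    case Rational
    have "((\<lambda>t. br C (u + \<sigma> * t)) has_field_derivative \<sigma>) (at 0)"
      unfolding Rational br.simps by (auto intro!: derivative_eq_intros)
    then show ?thesis using that assms(2) by blast
  qed
  then have "((\<lambda>t. br C (u + \<sigma> * t) / t) \<longlongrightarrow> D) (at 0)"
    unfolding has_field_derivative_iff using True by simp
  from tendsto_imp_eventually_ne[OF this D(2)] show ?thesis
    by eventually_elim auto
qed

lemma tendsto_A_plus: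
  assumes "A_plus_defined C \<delta> N i (\<lambda>j. \<sigma> * x j)"
  shows "((\<lambda>t. A_plus C \<mu> \<delta> \<kappa> N i (\<lambda>j. \<sigma> * (x j + t))) \<longlongrightarrow> A_plus C \<mu> \<delta> \<kappa> N i (\<lambda>j. \<sigma> * x j)) (at 0)"
proof -
  have x: "((\<lambda>t. \<sigma> * (x j + t)) \<longlongrightarrow> \<sigma> * x j) (at 0)" for j
    by (auto intro!: tendsto_eq_intros)
  have b: "((\<lambda>t. br C (\<sigma> * (x i + t) + e)) \<longlongrightarrow> br C (\<sigma> * x i + e)) (at 0)" for e
    by (intro tendsto_br tendsto_add[OF x] tendsto_const)
  have b': "((\<lambda>t. br C (\<sigma> * (x i + t) - e)) \<longlongrightarrow> br C (\<sigma> * x i - e)) (at 0)" for e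
    using b[of "- e"] by simp
  have q: "((\<lambda>t. pm (br C) (\<sigma> * (x i + t)) (\<sigma> * (x j + t)) e) \<longlongrightarrow> pm (br C) (\<sigma> * x i) (\<sigma> * x j) e) (at 0)" for j e
    by (intro tendsto_pm_br x)
  have nz: "(\<Prod>s = 1..rho C. br C (\<sigma> * x i - omega C s / 2) * br C (\<sigma> * x i + (\<delta> - omega C s) / 2)) \<noteq> 0"
    "\<And>j. j \<in> {1..N} - {i} \<Longrightarrow> pm (br C) (\<sigma> * x i) (\<sigma> * x j) 0 \<noteq> 0"
    using assms unfolding A_plus_defined_def by simp_all
  show ?thesis unfolding A_plus_def
    by (intro tendsto_mult[where a = "_ / _"] tendsto_divide tendsto_prod tendsto_mult[where a = "br _ _"] b b' q nz)
qed

lemma eventually_A_defined: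
  assumes "A_defined C \<delta> N x"
  shows "\<forall>\<^sub>F t in at 0. A_defined C \<delta> N (\<lambda>j. x j + t)"
proof -
  have x: "((\<lambda>t. \<sigma> * (x j + t)) \<longlongrightarrow> \<sigma> * x j) (at 0)" for \<sigma> j
    by (auto intro!: tendsto_eq_intros)
  have b: "\<forall>\<^sub>F t in at 0. br C (\<sigma> * (x i + t) + e) \<noteq> 0" if "br C (\<sigma> * x i + e) \<noteq> 0" for \<sigma> i e
    by (rule tendsto_imp_eventually_ne[OF _ that]) (intro tendsto_br tendsto_add[OF x] tendsto_const)
  have b': "\<forall>\<^sub>F t in at 0. br C (\<sigma> * (x i + t) - e) \<noteq> 0" if "br C (\<sigma> * x i - e) \<noteq> 0" for \<sigma> i e
    using b[of \<sigma> i "- e"] that by simp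
  have q: "\<forall>\<^sub>F t in at 0. pm (br C) (\<sigma> * (x i + t)) (\<sigma> * (x j + t)) 0 \<noteq> 0"
    if "pm (br C) (\<sigma> * x i) (\<sigma> * x j) 0 \<noteq> 0" for \<sigma> i j
    by (rule tendsto_imp_eventually_ne[OF _ that]) (intro tendsto_pm_br x)
  show ?thesis
    unfolding A_defined_def A_plus_defined_def
    by (intro eventually_ball_finite ballI eventually_conj finite_insert[THEN iffD2] finite.emptyI
          finite_atLeastAtMost finite_Diff b b' q)
       (use assms in \<open>unfold A_defined_def A_plus_defined_def, blast\<close>)+
qed

text \<open>
All \<open>x\<^sub>j\<close> move simultaneously and no \<open>y\<^sub>l\<close> does, so every combination \<open>\<sigma> x\<^sub>j + \<tau> y\<^sub>l\<close> moves with
speed \<open>\<plusminus>1\<close> and leaves the zeros of the bracket.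
\<close>

lemma eventually_separated:
  assumes "nondegenerate C"
  shows "\<forall>\<^sub>F t in at 0. separated C c m n (\<lambda>j. x j + t) y"
proof -
  have "\<forall>\<^sub>F t in at 0. br C (\<sigma> * (x j + t) + \<tau> * y l + c) \<noteq> 0" if "\<sigma> \<in> {1, -1}" for \<sigma> \<tau> j l
    using br_eventually_nonzero[OF assms, of \<sigma> "\<sigma> * x j + \<tau> * y l + c"] that
    by (auto simp: algebra_simps)
  then show ?thesis unfolding separated_def
    by (intro eventually_ball_finite ballI finite_insert[THEN iffD2] finite.emptyI finite_atLeastAtMost)
qed

lemma shift_translate: "shift i d (\<lambda>j. x j + t) = (\<lambda>j. shift i d x j + t)"
  by (auto simp: shift_def)

lemma D_defined_imp_A_defined:
  "D_defined C \<delta> N P x \<Longrightarrow> A_defined C \<delta> N x"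
  by (auto simp: D_defined_def A_defined_def)

lemma D_defined_imp_shift:
  "D_defined C \<delta> N P x \<Longrightarrow> \<sigma> \<in> {1, -1} \<Longrightarrow> i \<in> {1..N} \<Longrightarrow> P (shift i (\<sigma> * \<delta>) x)"
  by (auto simp: D_defined_def)

text \<open>
Translation by \<open>t\<close> commutes with the shifts of the operator, hence continuity of \<open>f\<close> along the
translations is needed only at the point and its shifts, where \<open>P\<close> holds.
\<close>

lemma tendsto_D_op_moving_point:
  assumes x: "D_defined C \<delta> N P x"
    and f: "\<And>X. P X \<Longrightarrow> ((\<lambda>t. f (\<lambda>j. X j + t)) \<longlongrightarrow> f X) (at 0)"
  shows "((\<lambda>t. D_op C \<mu> \<delta> \<kappa> N f (\<lambda>j. x j + t)) \<longlongrightarrow> D_op C \<mu> \<delta> \<kappa> N f x) (at 0)"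
proof -
  have "P x" using x by (simp add: D_defined_def)
  have "((\<lambda>t. A_plus C \<mu> \<delta> \<kappa> N i (\<lambda>j. \<sigma> * (x j + t)) * (f (\<lambda>j. shift i (\<sigma> * \<delta>) x j + t) - f (\<lambda>j. x j + t)))
      \<longlongrightarrow> A_plus C \<mu> \<delta> \<kappa> N i (\<lambda>j. \<sigma> * x j) * (f (shift i (\<sigma> * \<delta>) x) - f x)) (at 0)"
    if "\<sigma> \<in> {1, -1}" "i \<in> {1..N}" for \<sigma> i
    using D_defined_imp_A_defined[OF x] D_defined_imp_shift[OF x that] \<open>P x\<close> that
    by (intro tendsto_intros tendsto_A_plus f) (auto simp: A_defined_def)
  then show ?thesis unfolding D_op_signed shift_translate
    by (intro tendsto_sum) (auto simp only: mem_Sigma_iff split_paired_all case_prod_conv)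
qed

lemma tendsto_D_op_moving_function:
  assumes y: "D_defined C \<delta> N P y"
    and f: "\<And>Y. P Y \<Longrightarrow> ((\<lambda>t. f t Y) \<longlongrightarrow> g Y) (at 0)"
  shows "((\<lambda>t. D_op C \<mu> \<delta> \<kappa> N (f t) y) \<longlongrightarrow> D_op C \<mu> \<delta> \<kappa> N g y) (at 0)"
proof -
  have "P y" using y by (simp add: D_defined_def)
  have "((\<lambda>t. A_plus C \<mu> \<delta> \<kappa> N i (\<lambda>j. \<sigma> * y j) * (f t (shift i (\<sigma> * \<delta>) y) - f t y))
      \<longlongrightarrow> A_plus C \<mu> \<delta> \<kappa> N i (\<lambda>j. \<sigma> * y j) * (g (shift i (\<sigma> * \<delta>) y) - g y)) (at 0)"
    if "\<sigma> \<in> {1, -1}" "i \<in> {1..N}" for \<sigma> i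
    using D_defined_imp_shift[OF y that] \<open>P y\<close> by (intro tendsto_intros f)
  then show ?thesis unfolding D_op_signed
    by (intro tendsto_sum) (auto simp only: mem_Sigma_iff split_paired_all case_prod_conv)
qed

section \<open>Kernels built from a function of Gamma type\<close>

text \<open>
All three kernels are products over the pairs of variables, so their behaviour under a shift is determined by that of one
factor.
\<close>

definition pair_product :: "(complex \<Rightarrow> complex \<Rightarrow> complex) \<Rightarrow> nat \<Rightarrow> nat \<Rightarrow> (nat \<Rightarrow> complex) \<Rightarrow> (nat \<Rightarrow> complex) \<Rightarrow> complex" where
  "pair_product \<phi> m n x y = (\<Prod>j = 1..m. \<Prod>l = 1..n. \<phi> (x j) (y l))"

lemma pair_product_swap: "pair_product \<phi> m n x y = pair_product (\<lambda>u v. \<phi> v u) n m y x"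
  unfolding pair_product_def by (rule prod.swap)

lemma pair_product_shift:
  assumes "i \<in> {1..m}" "\<And>l. l \<in> {1..n} \<Longrightarrow> \<phi> (x i + d) (y l) = \<phi> (x i) (y l) * r l"
  shows "pair_product \<phi> m n (shift i d x) y = pair_product \<phi> m n x y * (\<Prod>l = 1..n. r l)"
proof -
  have "pair_product \<phi> m n (shift i d x) y = (\<Prod>l = 1..n. \<phi> (x i + d) (y l)) *
      (\<Prod>j\<in>{1..m} - {i}. \<Prod>l = 1..n. \<phi> (x j) (y l))"
    unfolding pair_product_def using assms(1)
    by (subst prod.remove[of _ i]) (auto simp: shift_def intro!: prod.cong)
  also have "(\<Prod>l = 1..n. \<phi> (x i + d) (y l)) = (\<Prod>l = 1..n. \<phi> (x i) (y l)) * (\<Prod>l = 1..n. r l)"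
    using assms(2) by (simp add: prod.distrib)
  finally show ?thesis
    unfolding pair_product_def using assms(1) by (subst prod.remove[of "{1..m}" i]) (auto simp: mult_ac)
qed

lemma pair_product_shift_right:
  assumes "i \<in> {1..n}" "\<And>j. j \<in> {1..m} \<Longrightarrow> \<phi> (x j) (y i + d) = \<phi> (x j) (y i) * r j"
  shows "pair_product \<phi> m n x (shift i d y) = pair_product \<phi> m n x y * (\<Prod>j = 1..m. r j)"
  unfolding pair_product_swap[of \<phi>] using assms by (rule pair_product_shift)

definition gamma_eq :: "bc_case \<Rightarrow> complex \<Rightarrow> complex \<Rightarrow> (complex \<Rightarrow> complex) \<Rightarrow> complex \<Rightarrow> bool" where
  "gamma_eq C \<delta> c\<^sub>0 G u \<longleftrightarrow> G (u + \<delta>) = c\<^sub>0 * br C u * G u"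

text \<open>
The functional equation fails at most on a discrete set, which a moving argument leaves at once.
\<close>

lemma eventually_gamma_eq:
  assumes "gamma_type C \<delta> c\<^sub>0 G" "\<sigma> \<noteq> 0"
  shows "\<forall>\<^sub>F t in at 0. gamma_eq C \<delta> c\<^sub>0 G (u + \<sigma> * t)"
proof -
  have "\<forall>\<^sub>F w in at u. gamma_eq C \<delta> c\<^sub>0 G w"
    using assms(1) eventually_cosparse_imp_eventually_at[of _ UNIV u UNIV]
    unfolding gamma_type_def gamma_eq_def by auto
  moreover have "filterlim (\<lambda>t. u + \<sigma> * t) (at u) (at 0)"
    unfolding filterlim_at using assms(2)
    by (auto intro!: tendsto_eq_intros simp: eventually_at_filter)
  ultimately show ?thesis by (rule eventually_compose_filterlim)
qed

text \<open>
The functional equation holds and the brackets do not vanish at the arguments that occur when \<open>u\<close> or \<open>v\<close> is shifted by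
\<open>\<delta>\<close> or by \<open>-\<delta>\<close>; the value \<open>e = \<delta>\<close> serves the backward shifts.
\<close>

definition regular_pair :: "bc_case \<Rightarrow> complex \<Rightarrow> complex \<Rightarrow> complex \<Rightarrow> (complex \<Rightarrow> complex) \<Rightarrow> complex \<Rightarrow> complex \<Rightarrow> bool" where
  "regular_pair C \<delta> \<kappa> c\<^sub>0 G u v \<longleftrightarrow> (\<forall>\<sigma>\<in>{1, -1}. \<forall>\<tau>\<in>{1, -1}. \<forall>d\<in>{(\<delta> - \<kappa>) / 2, (\<delta> + \<kappa>) / 2}.
     br C (\<sigma> * u + \<tau> * v + d) \<noteq> 0 \<and> (\<forall>e\<in>{0, \<delta>}. gamma_eq C \<delta> c\<^sub>0 G (\<sigma> * u + \<tau> * v + d - e)))"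

lemma eventually_regular_pair:
  assumes "nondegenerate C" "gamma_type C \<delta> c\<^sub>0 G"
  shows "\<forall>\<^sub>F t in at 0. regular_pair C \<delta> \<kappa> c\<^sub>0 G (u + t) v"
proof -
  have "\<forall>\<^sub>F t in at 0. br C (\<sigma> * (u + t) + \<tau> * v + d) \<noteq> 0" if "\<sigma> \<in> {1, -1}" for \<sigma> \<tau> d
    using br_eventually_nonzero[OF assms(1), of \<sigma> "\<sigma> * u + \<tau> * v + d"] that
    by (auto simp: algebra_simps)
  moreover have "\<forall>\<^sub>F t in at 0. gamma_eq C \<delta> c\<^sub>0 G (\<sigma> * (u + t) + \<tau> * v + d - e)" if "\<sigma> \<in> {1, -1}" for \<sigma> \<tau> d e
    using eventually_gamma_eq[OF assms(2), of \<sigma> "\<sigma> * u + \<tau> * v + d - e"] that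
    by (auto simp: algebra_simps)
  ultimately show ?thesis unfolding regular_pair_def
    by (intro eventually_ball_finite ballI eventually_conj finite_insert[THEN iffD2] finite.emptyI)
qed

lemma quot_step:
  fixes c c' :: complex
  assumes "c\<^sub>0 \<noteq> 0" and "\<And>\<tau> d. \<tau> \<in> {1, -1} \<Longrightarrow> d \<in> {c, c'} \<Longrightarrow> gamma_eq C \<delta> c\<^sub>0 G (u + \<tau> * v + d)"
  shows "pm G (u + \<delta>) v c / pm G (u + \<delta>) v c' =
    pm G u v c / pm G u v c' * (pm (br C) u v c / pm (br C) u v c')"
proof -
  have s: "pm G (u + \<delta>) v d = c\<^sub>0\<^sup>2 * (pm (br C) u v d * pm G u v d)" if "d \<in> {c, c'}" for d
  proof -
    have e: "u + \<delta> + v + d = u + v + d + \<delta>" "u + \<delta> - v + d = u - v + d + \<delta>" by auto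
    have "G (u + v + d + \<delta>) = c\<^sub>0 * br C (u + v + d) * G (u + v + d)"
      "G (u - v + d + \<delta>) = c\<^sub>0 * br C (u - v + d) * G (u - v + d)"
      using assms(2)[of 1 d] assms(2)[of "-1" d] that by (simp_all add: gamma_eq_def)
    then show ?thesis unfolding pm_def e by (simp only:) (simp add: power2_eq_square mult_ac)
  qed
  have "pm G (u + \<delta>) v c / pm G (u + \<delta>) v c' =
      (pm (br C) u v c * pm G u v c) / (pm (br C) u v c' * pm G u v c')"
    unfolding s[of c, simplified] s[of c', simplified] using assms(1) by simp
  then show ?thesis by (simp add: mult.commute)
qed


text \<open>
The two factors of \<open>pm G u v d\<close> react oppositely to a shift of \<open>v\<close>: one argument grows by \<open>\<delta>\<close>, the other one
decreases. The functional equation is used once in each direction, and \<open>c + c' = \<delta>\<close> exchanges the roles of \<open>c\<close> and \<open>c'\<close>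
in the backward one.
\<close>

lemma quot_step_right:
  fixes c c' :: complex
  assumes "c\<^sub>0 \<noteq> 0" "c + c' = \<delta>"
    and "\<And>d. d \<in> {c, c'} \<Longrightarrow> gamma_eq C \<delta> c\<^sub>0 G (u + v + d)"
    and "\<And>d. d \<in> {c, c'} \<Longrightarrow> gamma_eq C \<delta> c\<^sub>0 G (u - v + d - \<delta>)"
    and nz: "\<And>d. d \<in> {c, c'} \<Longrightarrow> br C (v - u + d) \<noteq> 0"
  shows "pm G u (v + \<delta>) c / pm G u (v + \<delta>) c' =
    pm G u v c / pm G u v c' * (pm (br C) v u c / pm (br C) v u c')"
proof -
  have s1: "G (u + (v + \<delta>) + d) = c\<^sub>0 * br C (v + u + d) * G (u + v + d)" if "d \<in> {c, c'}" for d
    using assms(3)[OF that] by (simp add: gamma_eq_def add_ac)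
  have s2: "G (u - v + d) = - c\<^sub>0 * br C (v - u + d') * G (u - (v + \<delta>) + d)"
    if "d \<in> {c, c'}" "d + d' = \<delta>" for d d'
  proof -
    have e: "u - v + d - \<delta> = - (v - u + d')" "u - (v + \<delta>) + d = u - v + d - \<delta>"
      using that(2) by (auto simp: algebra_simps)
    have "G (u - v + d) = c\<^sub>0 * br C (u - v + d - \<delta>) * G (u - v + d - \<delta>)"
      using assms(4)[OF that(1)] by (simp add: gamma_eq_def)
    then show ?thesis unfolding e(2) unfolding e(1) br_minus by simp
  qed
  have alg: "(z * p * g * w) / (z * p' * g' * w') = (g * (- z * b * w)) / (g' * (- z * b' * w')) * ((p * b') / (p' * b))"
    if "z \<noteq> 0" "b \<noteq> 0" "b' \<noteq> 0" for z p g w p' g' w' b b' :: complex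
    using that by (simp add: divide_simps)
  have "pm G u (v + \<delta>) c / pm G u (v + \<delta>) c' =
      (c\<^sub>0 * br C (v + u + c) * G (u + v + c) * G (u - (v + \<delta>) + c)) /
      (c\<^sub>0 * br C (v + u + c') * G (u + v + c') * G (u - (v + \<delta>) + c'))"
    unfolding pm_def by (simp add: s1)
  also have "\<dots> = pm G u v c / pm G u v c' * (pm (br C) v u c / pm (br C) v u c')"
    unfolding pm_def s2[of c c', simplified assms(2), simplified] s2[of c' c, simplified assms(2) add.commute[of c' c], simplified]
    using nz assms(1) by (subst alg[of c\<^sub>0 "br C (v - u + c')" "br C (v - u + c)"]) auto
  finally show ?thesis .
qed

text \<open>
The multiplier of the backward shift is the inverse of the forward multiplier at \<open>w - \<delta>\<close>; by \<open>c + c' = \<delta>\<close> and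
oddness of the bracket that inverse is the forward multiplier at \<open>-w\<close>.
\<close>

lemma signed_step:
  assumes step: "\<And>u. u \<in> {w, w - \<delta>} \<Longrightarrow> f (u + \<delta>) = f u * (pm (br C) u v c / pm (br C) u v c')"
    and "c + c' = \<delta>" "\<sigma> \<in> {1, -1}"
    and nz: "pm (br C) (- w) v c \<noteq> 0" "pm (br C) (- w) v c' \<noteq> 0"
  shows "f (w + \<sigma> * \<delta>) = f w * (pm (br C) (\<sigma> * w) v c / pm (br C) (\<sigma> * w) v c')"
proof (cases "\<sigma> = 1")
  case True
  then show ?thesis using step[of w] by simp
next
  case False
  then have \<sigma>: "\<sigma> = -1" using assms(3) by auto
  have e: "c - \<delta> = - c'" "c' - \<delta> = - c" using assms(2) by (auto simp: algebra_simps)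
  have "pm (br C) (w - \<delta>) v c = pm (br C) (- w) v c'" "pm (br C) (w - \<delta>) v c' = pm (br C) (- w) v c"
    using pm_reflect[of C "- w" v c] pm_reflect[of C "- w" v c'] unfolding pm_shift e by auto
  then have "f w = f (w - \<delta>) * (pm (br C) (- w) v c' / pm (br C) (- w) v c)"
    using step[of "w - \<delta>"] by simp
  then show ?thesis unfolding \<sigma> using nz by (simp add: field_simps)
qed

definition quot_pair :: "(complex \<Rightarrow> complex) \<Rightarrow> complex \<Rightarrow> complex \<Rightarrow> complex \<Rightarrow> complex \<Rightarrow> complex" where
  "quot_pair G \<delta> \<kappa> u v = pm G u v ((\<delta> - \<kappa>) / 2) / pm G u v ((\<delta> + \<kappa>) / 2)"

definition prod_pair :: "(complex \<Rightarrow> complex) \<Rightarrow> complex \<Rightarrow> complex \<Rightarrow> complex \<Rightarrow> complex \<Rightarrow> complex" where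
  "prod_pair G \<delta> \<kappa> u v = pm G u v ((\<delta> - \<kappa>) / 2) * pm G (- u) v ((\<delta> - \<kappa>) / 2)"

text \<open>
A factor with the multipliers \<open>Y\<close> and \<open>X\<close> that the first kernel identity requires.
\<close>

definition kernel_pair :: "bc_case \<Rightarrow> complex \<Rightarrow> complex \<Rightarrow> complex \<Rightarrow> (complex \<Rightarrow> complex) \<Rightarrow> (complex \<Rightarrow> complex \<Rightarrow> complex) \<Rightarrow> bool" where
  "kernel_pair C \<delta> \<kappa> c\<^sub>0 G \<phi> \<longleftrightarrow> (\<forall>u v. regular_pair C \<delta> \<kappa> c\<^sub>0 G u v \<longrightarrow> (\<forall>\<sigma>\<in>{1, -1}.
     \<phi> (u + \<sigma> * \<delta>) v = \<phi> u v * (pm (br C) (\<sigma> * u) v ((\<delta> - \<kappa>) / 2) / pm (br C) (\<sigma> * u) v ((\<delta> + \<kappa>) / 2)) \<and>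
     \<phi> u (v + \<sigma> * \<delta>) = \<phi> u v * (pm (br C) (\<sigma> * v) u ((\<delta> - \<kappa>) / 2) / pm (br C) (\<sigma> * v) u ((\<delta> + \<kappa>) / 2))))"

lemma regular_pairD:
  assumes "regular_pair C \<delta> \<kappa> c\<^sub>0 G u v" "d \<in> {(\<delta> - \<kappa>) / 2, (\<delta> + \<kappa>) / 2}"
  shows "br C (u + v + d) \<noteq> 0" "br C (u - v + d) \<noteq> 0" "br C (- u + v + d) \<noteq> 0" "br C (- u - v + d) \<noteq> 0"
    "e \<in> {0, \<delta>} \<Longrightarrow> gamma_eq C \<delta> c\<^sub>0 G (u + v + d - e)"
    "e \<in> {0, \<delta>} \<Longrightarrow> gamma_eq C \<delta> c\<^sub>0 G (u - v + d - e)"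
    "e \<in> {0, \<delta>} \<Longrightarrow> gamma_eq C \<delta> c\<^sub>0 G (- u + v + d - e)"
    "e \<in> {0, \<delta>} \<Longrightarrow> gamma_eq C \<delta> c\<^sub>0 G (- u - v + d - e)"
proof -
  have *: "br C (\<sigma> * u + \<tau> * v + d) \<noteq> 0" "e \<in> {0, \<delta>} \<Longrightarrow> gamma_eq C \<delta> c\<^sub>0 G (\<sigma> * u + \<tau> * v + d - e)"
    if "\<sigma> \<in> {1, -1}" "\<tau> \<in> {1, -1}" for \<sigma> \<tau>
    using assms that unfolding regular_pair_def by blast+
  show "br C (u + v + d) \<noteq> 0" "br C (u - v + d) \<noteq> 0" "br C (- u + v + d) \<noteq> 0" "br C (- u - v + d) \<noteq> 0"
    using *(1)[of 1 1] *(1)[of 1 "-1"] *(1)[of "-1" 1] *(1)[of "-1" "-1"] by simp_all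
  show "e \<in> {0, \<delta>} \<Longrightarrow> gamma_eq C \<delta> c\<^sub>0 G (u + v + d - e)" using *(2)[of 1 1] by simp
  show "e \<in> {0, \<delta>} \<Longrightarrow> gamma_eq C \<delta> c\<^sub>0 G (u - v + d - e)" using *(2)[of 1 "-1"] by simp
  show "e \<in> {0, \<delta>} \<Longrightarrow> gamma_eq C \<delta> c\<^sub>0 G (- u + v + d - e)" using *(2)[of "-1" 1] by simp
  show "e \<in> {0, \<delta>} \<Longrightarrow> gamma_eq C \<delta> c\<^sub>0 G (- u - v + d - e)" using *(2)[of "-1" "-1"] by simp
qed

lemma regular_pair_swap:
  "regular_pair C \<delta> \<kappa> c\<^sub>0 G u v \<Longrightarrow> regular_pair C \<delta> \<kappa> c\<^sub>0 G v u"
  unfolding regular_pair_def add.commute[of "_ * v" "_ * u"] by blast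

lemma regular_pair_pm:
  assumes "regular_pair C \<delta> \<kappa> c\<^sub>0 G u v"
  shows "pm (br C) (- u) v ((\<delta> - \<kappa>) / 2) \<noteq> 0" "pm (br C) (- u) v ((\<delta> + \<kappa>) / 2) \<noteq> 0"
  using regular_pairD(3,4)[OF assms] by (auto simp: pm_def)

lemma quot_pair_kernel:
  assumes "c\<^sub>0 \<noteq> 0"
  shows "kernel_pair C \<delta> \<kappa> c\<^sub>0 G (quot_pair G \<delta> \<kappa>)"
  unfolding kernel_pair_def
proof (intro allI impI ballI conjI)
  fix u v \<sigma> assume r: "regular_pair C \<delta> \<kappa> c\<^sub>0 G u v" and \<sigma>: "\<sigma> \<in> {1, -1 :: complex}"
  have cc: "(\<delta> - \<kappa>) / 2 + (\<delta> + \<kappa>) / 2 = \<delta>" by (simp add: field_simps)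
  have "quot_pair G \<delta> \<kappa> (u' + \<delta>) v = quot_pair G \<delta> \<kappa> u' v *
      (pm (br C) u' v ((\<delta> - \<kappa>) / 2) / pm (br C) u' v ((\<delta> + \<kappa>) / 2))" if u': "u' \<in> {u, u - \<delta>}" for u'
    unfolding quot_pair_def
  proof (rule quot_step[OF assms])
    fix \<tau> d :: complex assume "\<tau> \<in> {1, -1}" and d: "d \<in> {(\<delta> - \<kappa>) / 2, (\<delta> + \<kappa>) / 2}"
    then show "gamma_eq C \<delta> c\<^sub>0 G (u' + \<tau> * v + d)"
      using u' regular_pairD(5,6)[OF r d, of 0] regular_pairD(5,6)[OF r d, of \<delta>] by (auto simp: algebra_simps)
  qed
  then show "quot_pair G \<delta> \<kappa> (u + \<sigma> * \<delta>) v = quot_pair G \<delta> \<kappa> u v *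
      (pm (br C) (\<sigma> * u) v ((\<delta> - \<kappa>) / 2) / pm (br C) (\<sigma> * u) v ((\<delta> + \<kappa>) / 2))"
    by (rule signed_step[where f = "\<lambda>u. quot_pair G \<delta> \<kappa> u v", OF _ cc \<sigma> regular_pair_pm[OF r]])
  have "quot_pair G \<delta> \<kappa> u (v' + \<delta>) = quot_pair G \<delta> \<kappa> u v' *
      (pm (br C) v' u ((\<delta> - \<kappa>) / 2) / pm (br C) v' u ((\<delta> + \<kappa>) / 2))" if v': "v' \<in> {v, v - \<delta>}" for v'
    unfolding quot_pair_def
  proof (rule quot_step_right[OF assms cc])
    fix d assume d: "d \<in> {(\<delta> - \<kappa>) / 2, (\<delta> + \<kappa>) / 2}"
    show "gamma_eq C \<delta> c\<^sub>0 G (u + v' + d)"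
      using v' regular_pairD(5)[OF r d, of 0] regular_pairD(5)[OF r d, of \<delta>] by (auto simp: algebra_simps)
    show "gamma_eq C \<delta> c\<^sub>0 G (u - v' + d - \<delta>)"
      using v' regular_pairD(6)[OF r d, of 0] regular_pairD(6)[OF r d, of \<delta>] by (auto simp: algebra_simps)
    have d': "\<delta> - d \<in> {(\<delta> - \<kappa>) / 2, (\<delta> + \<kappa>) / 2}" using d by (auto simp: field_simps)
    have "v - \<delta> - u + d = - (u - v + (\<delta> - d))" by simp
    then have "br C (v - \<delta> - u + d) = - br C (u - v + (\<delta> - d))" by (simp only: br_minus)
    moreover have "- u + v + d = v - u + d" by simp
    ultimately show "br C (v' - u + d) \<noteq> 0"
      using v' regular_pairD(3)[OF r d] regular_pairD(2)[OF r d'] by auto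
  qed
  then show "quot_pair G \<delta> \<kappa> u (v + \<sigma> * \<delta>) = quot_pair G \<delta> \<kappa> u v *
      (pm (br C) (\<sigma> * v) u ((\<delta> - \<kappa>) / 2) / pm (br C) (\<sigma> * v) u ((\<delta> + \<kappa>) / 2))"
    by (rule signed_step[where f = "\<lambda>v. quot_pair G \<delta> \<kappa> u v", OF _ cc \<sigma> regular_pair_pm[OF regular_pair_swap[OF r]]])
qed

lemma prod_pair_swap: "prod_pair G \<delta> \<kappa> u v = prod_pair G \<delta> \<kappa> v u"
  by (simp add: prod_pair_def pm_def add_ac) (simp add: algebra_simps)

text \<open>
The factor \<open>pm G u v c\<close> supplies the numerator of the multiplier. In \<open>pm G (- u) v c\<close> the arguments decrease, so it
supplies the denominator.
\<close>

lemma prod_step: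
  assumes "c\<^sub>0 \<noteq> 0" "c + c' = \<delta>"
    and "\<And>\<tau>. \<tau> \<in> {1, -1} \<Longrightarrow> gamma_eq C \<delta> c\<^sub>0 G (u + \<tau> * v + c) \<and> gamma_eq C \<delta> c\<^sub>0 G (- u - \<delta> + \<tau> * v + c)"
    and nz: "pm (br C) u v c' \<noteq> 0"
  shows "pm G (u + \<delta>) v c * pm G (- (u + \<delta>)) v c =
    (pm G u v c * pm G (- u) v c) * (pm (br C) u v c / pm (br C) u v c')"
proof -
  have gen: "pm G (w + \<delta>) v c = c\<^sub>0\<^sup>2 * (pm (br C) w v c * pm G w v c)"
    if "gamma_eq C \<delta> c\<^sub>0 G (w + v + c)" "gamma_eq C \<delta> c\<^sub>0 G (w - v + c)" for w
  proof -
    have e: "w + \<delta> + v + c = w + v + c + \<delta>" "w + \<delta> - v + c = w - v + c + \<delta>" by auto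
    show ?thesis using that unfolding pm_def e gamma_eq_def by (simp only:) (simp add: power2_eq_square mult_ac)
  qed
  have 1: "pm G (u + \<delta>) v c = c\<^sub>0\<^sup>2 * (pm (br C) u v c * pm G u v c)"
    by (rule gen) (use assms(3)[of 1] assms(3)[of "-1"] in simp_all)
  have w: "- u = - (u + \<delta>) + \<delta>" by simp
  have "c - \<delta> = - c'" using assms(2) by (auto simp: algebra_simps)
  then have "pm (br C) (- (u + \<delta>)) v c = pm (br C) u v c'"
    using pm_reflect[of C u v c'] pm_shift[of "br C" "- u" \<delta> v c] by (simp only: minus_add_distrib) simp
  moreover have "pm G (- (u + \<delta>) + \<delta>) v c = c\<^sub>0\<^sup>2 * (pm (br C) (- (u + \<delta>)) v c * pm G (- (u + \<delta>)) v c)"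
    by (rule gen) (use assms(3)[of 1] assms(3)[of "-1"] in simp_all)
  ultimately have "pm G (- u) v c = c\<^sub>0\<^sup>2 * (pm (br C) u v c' * pm G (- (u + \<delta>)) v c)"
    by (simp add: w[symmetric])
  then show ?thesis using 1 nz assms(1) by (simp add: field_simps)
qed

lemma prod_pair_kernel:
  assumes "c\<^sub>0 \<noteq> 0"
  shows "kernel_pair C \<delta> \<kappa> c\<^sub>0 G (prod_pair G \<delta> \<kappa>)"
proof -
  have cc: "(\<delta> - \<kappa>) / 2 + (\<delta> + \<kappa>) / 2 = \<delta>" by (simp add: field_simps)
  have left: "prod_pair G \<delta> \<kappa> (u + \<sigma> * \<delta>) v = prod_pair G \<delta> \<kappa> u v *
      (pm (br C) (\<sigma> * u) v ((\<delta> - \<kappa>) / 2) / pm (br C) (\<sigma> * u) v ((\<delta> + \<kappa>) / 2))"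
    if r: "regular_pair C \<delta> \<kappa> c\<^sub>0 G u v" and \<sigma>: "\<sigma> \<in> {1, -1}" for u v \<sigma>
  proof (rule signed_step[where f = "\<lambda>u. prod_pair G \<delta> \<kappa> u v", OF _ cc \<sigma> regular_pair_pm[OF r]])
    fix u' assume u': "u' \<in> {u, u - \<delta>}"
    let ?c = "(\<delta> - \<kappa>) / 2" and ?c' = "(\<delta> + \<kappa>) / 2"
    have c: "?c \<in> {?c, ?c'}" "?c' \<in> {?c, ?c'}" by auto
    show "prod_pair G \<delta> \<kappa> (u' + \<delta>) v = prod_pair G \<delta> \<kappa> u' v * (pm (br C) u' v ?c / pm (br C) u' v ?c')"
      unfolding prod_pair_def
    proof (rule prod_step[OF assms cc])
      fix \<tau> :: complex assume "\<tau> \<in> {1, -1}"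
      then have *: "gamma_eq C \<delta> c\<^sub>0 G (s * u + \<tau> * v + ?c - e)" if "s \<in> {1, -1}" "e \<in> {0, \<delta>}" for s e
        using r that unfolding regular_pair_def by blast
      have "gamma_eq C \<delta> c\<^sub>0 G (u + \<tau> * v + ?c)" "gamma_eq C \<delta> c\<^sub>0 G (u + \<tau> * v + ?c - \<delta>)"
        "gamma_eq C \<delta> c\<^sub>0 G (- u + \<tau> * v + ?c)" "gamma_eq C \<delta> c\<^sub>0 G (- u + \<tau> * v + ?c - \<delta>)"
        using *[of 1 0] *[of 1 \<delta>] *[of "-1" 0] *[of "-1" \<delta>] by simp_all
      moreover have "u - \<delta> + \<tau> * v + ?c = u + \<tau> * v + ?c - \<delta>" "- u - \<delta> + \<tau> * v + ?c = - u + \<tau> * v + ?c - \<delta>"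
        "- (u - \<delta>) - \<delta> + \<tau> * v + ?c = - u + \<tau> * v + ?c" by auto
      ultimately show "gamma_eq C \<delta> c\<^sub>0 G (u' + \<tau> * v + ?c) \<and> gamma_eq C \<delta> c\<^sub>0 G (- u' - \<delta> + \<tau> * v + ?c)"
        using u' by (elim insertE emptyE) (simp_all only: simp_thms)
    next
      have "c - \<delta> = - (\<delta> - c)" for c by simp
      then have "pm (br C) (u - \<delta>) v ?c' = pm (br C) (- u) v ?c"
        using pm_reflect[of C "- u" v ?c] cc unfolding pm_shift by (metis add_diff_cancel_right' minus_minus)
      then show "pm (br C) u' v ?c' \<noteq> 0"
        using u' regular_pairD(1,2)[OF r c(2)] regular_pair_pm(1)[OF r] by (auto simp: pm_def)
    qed
  qed
  show ?thesis unfolding kernel_pair_def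
  proof (intro allI impI ballI conjI)
    fix u v \<sigma> assume r: "regular_pair C \<delta> \<kappa> c\<^sub>0 G u v" and \<sigma>: "\<sigma> \<in> {1, -1 :: complex}"
    show "prod_pair G \<delta> \<kappa> (u + \<sigma> * \<delta>) v = prod_pair G \<delta> \<kappa> u v *
      (pm (br C) (\<sigma> * u) v ((\<delta> - \<kappa>) / 2) / pm (br C) (\<sigma> * u) v ((\<delta> + \<kappa>) / 2))"
      by (rule left[OF r \<sigma>])
    show "prod_pair G \<delta> \<kappa> u (v + \<sigma> * \<delta>) = prod_pair G \<delta> \<kappa> u v *
      (pm (br C) (\<sigma> * v) u ((\<delta> - \<kappa>) / 2) / pm (br C) (\<sigma> * v) u ((\<delta> + \<kappa>) / 2))"
      using left[OF regular_pair_swap[OF r] \<sigma>] by (simp only: prod_pair_swap[of G \<delta> \<kappa> u])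
  qed
qed

section \<open>The kernel identities\<close>

lemma limits_agree:
  fixes f g :: "complex \<Rightarrow> complex"
  assumes "(f \<longlongrightarrow> a) (at 0)" "(g \<longlongrightarrow> b) (at 0)" "\<forall>\<^sub>F t in at 0. f t = g t"
  shows "a = b"
  by (rule tendsto_unique[OF trivial_limit_at assms(1) iffD2[OF tendsto_cong[OF assms(3)] assms(2)]])

text \<open>
The hypothesis \<open>regular_pair\<close> may fail at \<open>(x, y)\<close> itself, for example where \<open>prod_pair\<close> vanishes and its multiplier has a pole.
It holds at \<open>(x + t, y)\<close> for small \<open>t \<noteq> 0\<close>, and both sides are continuous in \<open>t\<close>.
\<close>

lemma kernel_identity_first_extended:
  assumes C: "nondegenerate C" and G: "gamma_type C \<delta> c\<^sub>0 G" and \<phi>: "kernel_pair C \<delta> \<kappa> c\<^sub>0 G \<phi>"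
    and \<Phi>: "\<Phi> = pair_product \<phi> m n"
    and \<nu>: "\<And>r. r \<in> {1..2 * rho C} \<Longrightarrow> \<nu> r = (\<delta> + \<kappa>) / 2 - \<mu> r"
    and cont: "\<And>X Y. P X Y \<Longrightarrow> ((\<lambda>t. \<Phi> (\<lambda>j. X j + t) Y) \<longlongrightarrow> \<Phi> X Y) (at 0)"
    and x: "D_defined C \<delta> m (\<lambda>x'. P x' y) x" and y: "D_defined C \<delta> n (\<lambda>y'. P x y') y"
  shows "br C \<kappa> * D_op C \<mu> \<delta> \<kappa> m (\<lambda>x'. \<Phi> x' y) x -
      br C \<kappa> * D_op C \<nu> \<delta> \<kappa> n (\<lambda>y'. \<Phi> x y') y =
    eigenvalue C (of_nat m * \<kappa>) (of_nat n * - \<kappa>) (c_const C \<mu> \<delta> \<kappa>) * \<Phi> x y"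
    (is "?L x = ?R x")
proof -
  have Pxy: "P x y" using x by (simp add: D_defined_def)
  have "((\<lambda>t. ?L (\<lambda>j. x j + t)) \<longlongrightarrow> ?L x) (at 0)"
    by (intro tendsto_intros tendsto_D_op_moving_point[OF x] tendsto_D_op_moving_function[OF y] cont)
  moreover have "((\<lambda>t. ?R (\<lambda>j. x j + t)) \<longlongrightarrow> ?R x) (at 0)"
    by (intro tendsto_intros cont Pxy)
  moreover have "\<forall>\<^sub>F t in at 0. ?L (\<lambda>j. x j + t) = ?R (\<lambda>j. x j + t)"
  proof -
    have "\<forall>\<^sub>F t in at 0. \<forall>j\<in>{1..m}. \<forall>l\<in>{1..n}. regular_pair C \<delta> \<kappa> c\<^sub>0 G (x j + t) (y l)"
      by (intro eventually_ball_finite ballI finite_atLeastAtMost eventually_regular_pair C G)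
    with eventually_A_defined[OF D_defined_imp_A_defined[OF x]]
      eventually_separated[OF C, of "(\<delta> + \<kappa>) / 2" m n x y]
    show ?thesis
    proof eventually_elim
      case (elim t)
      have reg: "regular_pair C \<delta> \<kappa> c\<^sub>0 G (x j + t) (y l)" if "j \<in> {1..m}" "l \<in> {1..n}" for j l
        using elim(3) that by blast
      show ?case
      proof (rule kernel_identity_first[OF C elim(1) D_defined_imp_A_defined[OF y] elim(2) \<nu>])
        show "\<forall>\<sigma>\<in>{1, -1}. \<forall>i\<in>{1..m}. \<Phi> (shift i (\<sigma> * \<delta>) (\<lambda>j. x j + t)) y =
          \<Phi> (\<lambda>j. x j + t) y *
          (\<Prod>l = 1..n. pm (br C) (\<sigma> * (x i + t)) (y l) ((\<delta> - \<kappa>) / 2) /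
             pm (br C) (\<sigma> * (x i + t)) (y l) ((\<delta> + \<kappa>) / 2))"
          using \<phi> reg unfolding kernel_pair_def \<Phi> by (intro ballI pair_product_shift) blast+
        show "\<forall>\<sigma>\<in>{1, -1}. \<forall>i\<in>{1..n}. \<Phi> (\<lambda>j. x j + t) (shift i (\<sigma> * \<delta>) y) =
          \<Phi> (\<lambda>j. x j + t) y *
          (\<Prod>j = 1..m. pm (br C) (\<sigma> * y i) (x j + t) ((\<delta> - \<kappa>) / 2) /
             pm (br C) (\<sigma> * y i) (x j + t) ((\<delta> + \<kappa>) / 2))"
          using \<phi> reg unfolding kernel_pair_def \<Phi> by (intro ballI pair_product_shift_right) blast+
      qed
    qed
  qed
  ultimately show ?thesis by (rule limits_agree)
qed

text \<open>
For \<open>\<Psi>\<close> the multipliers need no functional equation, only a nonzero factor to divide by.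
\<close>

lemma Psi_step:
  assumes "br C (u + v) \<noteq> 0" "br C (u - v) \<noteq> 0" "\<sigma> \<in> {1, -1}"
  shows "pm (br C) (u + \<sigma> * \<delta>) v 0 = pm (br C) u v 0 * (pm (br C) (\<sigma> * u) v \<delta> / pm (br C) (\<sigma> * u) v 0)"
    and "pm (br C) u (v + \<sigma> * \<delta>) 0 = pm (br C) u v 0 * (pm (br C) (\<sigma> * v) u \<delta> / pm (br C) (\<sigma> * v) u 0)"
proof -
  have left: "pm (br C) (u + \<sigma> * \<delta>) v 0 = pm (br C) u v 0 * (pm (br C) (\<sigma> * u) v \<delta> / pm (br C) (\<sigma> * u) v 0)"
    if nz: "pm (br C) u v 0 \<noteq> 0" for u v
  proof -
    have "pm (br C) (u + \<sigma> * \<delta>) v 0 = pm (br C) (\<sigma> * u) v \<delta>"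
      using assms(3) pm_shift[of "br C" u \<delta> v 0] pm_shift[of "br C" u "- \<delta>" v 0] pm_reflect[of C u v \<delta>]
        pm_reflect[of C "- u" v \<delta>] by auto
    moreover have "pm (br C) (\<sigma> * u) v 0 = pm (br C) u v 0"
      using assms(3) pm_reflect[of C u v 0] by auto
    ultimately show ?thesis using nz by simp
  qed
  have swap: "pm (br C) u v 0 = - pm (br C) v u 0" for u v
    using br_minus[of C "v - u"] by (simp add: pm_def add.commute)
  have nz: "pm (br C) u v 0 \<noteq> 0" using assms by (simp add: pm_def)
  then have nz': "pm (br C) v u 0 \<noteq> 0" unfolding swap[of u v] by simp
  show "pm (br C) (u + \<sigma> * \<delta>) v 0 = pm (br C) u v 0 * (pm (br C) (\<sigma> * u) v \<delta> / pm (br C) (\<sigma> * u) v 0)"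
    by (rule left[OF nz])
  show "pm (br C) u (v + \<sigma> * \<delta>) 0 = pm (br C) u v 0 * (pm (br C) (\<sigma> * v) u \<delta> / pm (br C) (\<sigma> * v) u 0)"
    unfolding swap[of u] left[OF nz'] by simp
qed

lemma kernel_identity_second_extended:
  assumes C: "nondegenerate C"
    and x: "D_defined C \<delta> m (\<lambda>_. True) x" and y: "D_defined C \<kappa> n (\<lambda>_. True) y"
  shows "br C \<kappa> * D_op C \<mu> \<delta> \<kappa> m (\<lambda>x'. Psi C m n x' y) x + br C \<delta> * D_op C \<mu> \<kappa> \<delta> n (\<lambda>y'. Psi C m n x y') y =
    eigenvalue C (of_nat m * \<kappa>) (of_nat n * \<delta>) (c_const C \<mu> \<delta> \<kappa>) * Psi C m n x y"
    (is "?L x = ?R x")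
proof -
  have Psi: "Psi C m n = pair_product (\<lambda>u v. pm (br C) u v 0) m n"
    by (intro ext) (simp add: Psi_def pair_product_def)
  have cont: "((\<lambda>t. Psi C m n (\<lambda>j. X j + t) Y) \<longlongrightarrow> Psi C m n X Y) (at 0)" for X Y
    unfolding Psi_def by (intro tendsto_prod tendsto_pm_br) (auto intro!: tendsto_eq_intros)
  have "((\<lambda>t. ?L (\<lambda>j. x j + t)) \<longlongrightarrow> ?L x) (at 0)"
    by (intro tendsto_intros tendsto_D_op_moving_point[OF x] tendsto_D_op_moving_function[OF y] cont)
  moreover have "((\<lambda>t. ?R (\<lambda>j. x j + t)) \<longlongrightarrow> ?R x) (at 0)"
    by (intro tendsto_intros cont)
  moreover have "\<forall>\<^sub>F t in at 0. ?L (\<lambda>j. x j + t) = ?R (\<lambda>j. x j + t)"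
    using eventually_A_defined[OF D_defined_imp_A_defined[OF x]] eventually_separated[OF C, of 0 m n x y]
  proof eventually_elim
    case (elim t)
    have nz: "br C (x j + t + y l) \<noteq> 0" "br C (x j + t - y l) \<noteq> 0" if "j \<in> {1..m}" "l \<in> {1..n}" for j l
    proof -
      have "br C (1 * (x j + t) + 1 * y l + 0) \<noteq> 0" "br C (1 * (x j + t) + (-1) * y l + 0) \<noteq> 0"
        using elim(2) that unfolding separated_def by blast+
      then show "br C (x j + t + y l) \<noteq> 0" "br C (x j + t - y l) \<noteq> 0" by simp_all
    qed
    show ?case unfolding Psi
      by (rule kernel_identity_second[OF C elim(1) D_defined_imp_A_defined[OF y] elim(2)];
          intro ballI pair_product_shift pair_product_shift_right Psi_step nz)
  qed
  ultimately show ?thesis by (rule limits_agree)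
qed

lemma tendsto_analytic_compose:
  assumes "G analytic_on {u :: complex}" "(f \<longlongrightarrow> u) F"
  shows "((\<lambda>t. G (f t)) \<longlongrightarrow> G u) F"
  by (rule isCont_tendsto_compose[OF analytic_at_imp_isCont[OF assms(1)] assms(2)])

lemma Phi_quot_pair_product: "Phi_quot G \<delta> \<kappa> m n = pair_product (quot_pair G \<delta> \<kappa>) m n"
  by (intro ext) (simp only: Phi_quot_def pair_product_def quot_pair_def)

lemma Phi_prod_pair_product: "Phi_prod G \<delta> \<kappa> m n = pair_product (prod_pair G \<delta> \<kappa>) m n"
proof (intro ext)
  fix x y
  have sign: "(\<Prod>\<epsilon>\<in>{1, -1}. h \<epsilon>) = h 1 * h (-1)" for h :: "complex \<Rightarrow> complex" by simp
  show "Phi_prod G \<delta> \<kappa> m n x y = pair_product (prod_pair G \<delta> \<kappa>) m n x y"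
    unfolding Phi_prod_def pair_product_def prod_pair_def pm_def sign
    by (simp only: mult_minus1 mult_1 diff_conv_add_uminus)
qed

lemma tendsto_Phi_quot:
  assumes "Phi_quot_defined G \<delta> \<kappa> m n X Y"
  shows "((\<lambda>t. Phi_quot G \<delta> \<kappa> m n (\<lambda>j. X j + t) Y) \<longlongrightarrow> Phi_quot G \<delta> \<kappa> m n X Y) (at 0)"
  unfolding Phi_quot_def pm_def
proof (intro tendsto_prod tendsto_divide tendsto_mult)
  fix j l assume jl: "j \<in> {1..m}" "l \<in> {1..n}"
  have P: "G analytic_on {X j + 1 * Y l + (\<delta> - \<kappa>) / 2}" "G analytic_on {X j + (-1) * Y l + (\<delta> - \<kappa>) / 2}"
    "G analytic_on {X j + 1 * Y l + (\<delta> + \<kappa>) / 2}" "G analytic_on {X j + (-1) * Y l + (\<delta> + \<kappa>) / 2}"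
    "G (X j + 1 * Y l + (\<delta> + \<kappa>) / 2) \<noteq> 0" "G (X j + (-1) * Y l + (\<delta> + \<kappa>) / 2) \<noteq> 0"
    using assms jl unfolding Phi_quot_defined_def by blast+
  show "((\<lambda>t. G (X j + t + Y l + (\<delta> - \<kappa>) / 2)) \<longlongrightarrow> G (X j + Y l + (\<delta> - \<kappa>) / 2)) (at 0)"
    by (rule tendsto_analytic_compose) (use P in \<open>auto intro!: tendsto_eq_intros\<close>)
  show "((\<lambda>t. G (X j + t - Y l + (\<delta> - \<kappa>) / 2)) \<longlongrightarrow> G (X j - Y l + (\<delta> - \<kappa>) / 2)) (at 0)"
    by (rule tendsto_analytic_compose) (use P in \<open>auto intro!: tendsto_eq_intros\<close>)
  show "((\<lambda>t. G (X j + t + Y l + (\<delta> + \<kappa>) / 2)) \<longlongrightarrow> G (X j + Y l + (\<delta> + \<kappa>) / 2)) (at 0)"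
    by (rule tendsto_analytic_compose) (use P in \<open>auto intro!: tendsto_eq_intros\<close>)
  show "((\<lambda>t. G (X j + t - Y l + (\<delta> + \<kappa>) / 2)) \<longlongrightarrow> G (X j - Y l + (\<delta> + \<kappa>) / 2)) (at 0)"
    by (rule tendsto_analytic_compose) (use P in \<open>auto intro!: tendsto_eq_intros\<close>)
  show "G (X j + Y l + (\<delta> + \<kappa>) / 2) * G (X j - Y l + (\<delta> + \<kappa>) / 2) \<noteq> 0"
    using P by simp
qed

lemma tendsto_Phi_prod:
  assumes "Phi_prod_defined G \<delta> \<kappa> m n X Y"
  shows "((\<lambda>t. Phi_prod G \<delta> \<kappa> m n (\<lambda>j. X j + t) Y) \<longlongrightarrow> Phi_prod G \<delta> \<kappa> m n X Y) (at 0)"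
  unfolding Phi_prod_def
proof (intro tendsto_prod)
  fix j l \<epsilon>\<^sub>1 \<epsilon>\<^sub>2 assume "j \<in> {1..m}" "l \<in> {1..n}" "\<epsilon>\<^sub>1 \<in> {1, -1 :: complex}" "\<epsilon>\<^sub>2 \<in> {1, -1 :: complex}"
  then have "G analytic_on {\<epsilon>\<^sub>1 * X j + \<epsilon>\<^sub>2 * Y l + (\<delta> - \<kappa>) / 2}"
    using assms unfolding Phi_prod_defined_def by blast
  then show "((\<lambda>t. G (\<epsilon>\<^sub>1 * (X j + t) + \<epsilon>\<^sub>2 * Y l + (\<delta> - \<kappa>) / 2)) \<longlongrightarrow> G (\<epsilon>\<^sub>1 * X j + \<epsilon>\<^sub>2 * Y l + (\<delta> - \<kappa>) / 2)) (at 0)"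
    by (rule tendsto_analytic_compose) (auto intro!: tendsto_eq_intros)
qed

theorem theorem2p5:
  fixes C :: bc_case and \<delta> \<kappa> :: complex and \<mu> \<nu> :: "nat \<Rightarrow> complex" and m n :: nat
  assumes "case C of Trigonometric \<omega>\<^sub>1 \<Rightarrow> \<omega>\<^sub>1 \<noteq> 0 | Rational \<Rightarrow> True"
    and "\<delta> \<notin> Omega C" and "\<kappa> \<notin> Omega C"
    and "\<And>r. r \<in> {1..2 * rho C} \<Longrightarrow> \<nu> r = (\<delta> + \<kappa>) / 2 - \<mu> r"
  shows
    "(\<forall>G c\<^sub>0. c\<^sub>0 \<noteq> 0 \<and> gamma_type C \<delta> c\<^sub>0 G \<longrightarrow>
        (\<forall>(\<Phi>, \<Phi>_defined) \<in> {(Phi_quot G \<delta> \<kappa> m n, Phi_quot_defined G \<delta> \<kappa> m n),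
                              (Phi_prod G \<delta> \<kappa> m n, Phi_prod_defined G \<delta> \<kappa> m n)}.
         \<forall>x y. D_defined C \<delta> m (\<lambda>x'. \<Phi>_defined x' y) x \<and>
               D_defined C \<delta> n (\<lambda>y'. \<Phi>_defined x y') y \<longrightarrow>
           br C \<kappa> * D_op C \<mu> \<delta> \<kappa> m (\<lambda>x'. \<Phi> x' y) x - br C \<kappa> * D_op C \<nu> \<delta> \<kappa> n (\<lambda>y'. \<Phi> x y') y =
           (case C of
              Trigonometric _ \<Rightarrow>
                br C (of_nat m * \<kappa>) * br C (- of_nat n * \<kappa>) *
                br C ((of_nat m - of_nat n) * \<kappa> + c_const C \<mu> \<delta> \<kappa>) * \<Phi> x y
            | Rational \<Rightarrow> 0)))
     \<and>
     (\<forall>x y. D_defined C \<delta> m (\<lambda>_. True) x \<and> D_defined C \<kappa> n (\<lambda>_. True) y \<longrightarrow>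
        br C \<kappa> * D_op C \<mu> \<delta> \<kappa> m (\<lambda>x'. Psi C m n x' y) x +
        br C \<delta> * D_op C \<mu> \<kappa> \<delta> n (\<lambda>y'. Psi C m n x y') y =
        (case C of
           Trigonometric _ \<Rightarrow>
             br C (of_nat m * \<kappa>) * br C (of_nat n * \<delta>) *
             br C (of_nat m * \<kappa> + of_nat n * \<delta> + c_const C \<mu> \<delta> \<kappa>) * Psi C m n x y
         | Rational \<Rightarrow> 0))"
proof (intro conjI allI impI)
  have C: "nondegenerate C" using assms(1) by (simp add: nondegenerate_def)
  fix x y assume D: "D_defined C \<delta> m (\<lambda>_. True) x \<and> D_defined C \<kappa> n (\<lambda>_. True) y"
  show "br C \<kappa> * D_op C \<mu> \<delta> \<kappa> m (\<lambda>x'. Psi C m n x' y) x +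
        br C \<delta> * D_op C \<mu> \<kappa> \<delta> n (\<lambda>y'. Psi C m n x y') y =
        (case C of
           Trigonometric _ \<Rightarrow>
             br C (of_nat m * \<kappa>) * br C (of_nat n * \<delta>) *
             br C (of_nat m * \<kappa> + of_nat n * \<delta> + c_const C \<mu> \<delta> \<kappa>) * Psi C m n x y
         | Rational \<Rightarrow> 0)"
    using kernel_identity_second_extended[OF C conjunct1[OF D] conjunct2[OF D], of \<mu>]
    unfolding eigenvalue_def by (cases C) simp_all
next
  have C: "nondegenerate C" using assms(1) by (simp add: nondegenerate_def)
  fix G c\<^sub>0 assume G: "c\<^sub>0 \<noteq> 0 \<and> gamma_type C \<delta> c\<^sub>0 G"
  have eig: "eigenvalue C (of_nat m * \<kappa>) (of_nat n * - \<kappa>) (c_const C \<mu> \<delta> \<kappa>) * F =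
      (case C of Trigonometric _ \<Rightarrow> br C (of_nat m * \<kappa>) * br C (- of_nat n * \<kappa>) *
         br C ((of_nat m - of_nat n) * \<kappa> + c_const C \<mu> \<delta> \<kappa>) * F | Rational \<Rightarrow> 0)" for F
    unfolding eigenvalue_def by (cases C) (simp_all add: left_diff_distrib)
  have quot: "br C \<kappa> * D_op C \<mu> \<delta> \<kappa> m (\<lambda>x'. Phi_quot G \<delta> \<kappa> m n x' y) x -
      br C \<kappa> * D_op C \<nu> \<delta> \<kappa> n (\<lambda>y'. Phi_quot G \<delta> \<kappa> m n x y') y =
      eigenvalue C (of_nat m * \<kappa>) (of_nat n * - \<kappa>) (c_const C \<mu> \<delta> \<kappa>) * Phi_quot G \<delta> \<kappa> m n x y"
    if "D_defined C \<delta> m (\<lambda>x'. Phi_quot_defined G \<delta> \<kappa> m n x' y) x"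
      "D_defined C \<delta> n (\<lambda>y'. Phi_quot_defined G \<delta> \<kappa> m n x y') y" for x y
    by (rule kernel_identity_first_extended[where P = "Phi_quot_defined G \<delta> \<kappa> m n",
          OF C conjunct2[OF G] quot_pair_kernel[OF conjunct1[OF G]] Phi_quot_pair_product])
       (fact assms(4) tendsto_Phi_quot that)+
  have prod: "br C \<kappa> * D_op C \<mu> \<delta> \<kappa> m (\<lambda>x'. Phi_prod G \<delta> \<kappa> m n x' y) x -
      br C \<kappa> * D_op C \<nu> \<delta> \<kappa> n (\<lambda>y'. Phi_prod G \<delta> \<kappa> m n x y') y =
      eigenvalue C (of_nat m * \<kappa>) (of_nat n * - \<kappa>) (c_const C \<mu> \<delta> \<kappa>) * Phi_prod G \<delta> \<kappa> m n x y"
    if "D_defined C \<delta> m (\<lambda>x'. Phi_prod_defined G \<delta> \<kappa> m n x' y) x"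
      "D_defined C \<delta> n (\<lambda>y'. Phi_prod_defined G \<delta> \<kappa> m n x y') y" for x y
    by (rule kernel_identity_first_extended[where P = "Phi_prod_defined G \<delta> \<kappa> m n",
          OF C conjunct2[OF G] prod_pair_kernel[OF conjunct1[OF G]] Phi_prod_pair_product])
       (fact assms(4) tendsto_Phi_prod that)+
  show "\<forall>(\<Phi>, \<Phi>_defined) \<in> {(Phi_quot G \<delta> \<kappa> m n, Phi_quot_defined G \<delta> \<kappa> m n),
                              (Phi_prod G \<delta> \<kappa> m n, Phi_prod_defined G \<delta> \<kappa> m n)}.
         \<forall>x y. D_defined C \<delta> m (\<lambda>x'. \<Phi>_defined x' y) x \<and>
               D_defined C \<delta> n (\<lambda>y'. \<Phi>_defined x y') y \<longrightarrow>
           br C \<kappa> * D_op C \<mu> \<delta> \<kappa> m (\<lambda>x'. \<Phi> x' y) x - br C \<kappa> * D_op C \<nu> \<delta> \<kappa> n (\<lambda>y'. \<Phi> x y') y =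
           (case C of
              Trigonometric _ \<Rightarrow>
                br C (of_nat m * \<kappa>) * br C (- of_nat n * \<kappa>) *
                br C ((of_nat m - of_nat n) * \<kappa> + c_const C \<mu> \<delta> \<kappa>) * \<Phi> x y
            | Rational \<Rightarrow> 0)"
    using quot prod by (simp add: eig[symmetric])
qed

end
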